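(* Let $-\infty<\kappa_1<\kappa_2<+\infty$ and $\boldsymbol{P},\boldsymbol{Q}\in\mathrm{SO}_3(\mathbb{R})$. Then the metric spaces $(\mathcal{P}_{\kappa_1}^{\kappa_2}(\boldsymbol{P},\boldsymbol{Q}),d^0)$ and $(\mathcal{P}_{\kappa_1}^{\kappa_2}(\boldsymbol{P},\boldsymbol{Q}),d^1)$ generate the same topology, where, for curves $\alpha,\beta:[0,1]\to\mathbb{S}^2$ parameterized with constant speed, $d^0(\alpha,\beta)=\max\{d(\alpha(t),\beta(t)):t\in[0,1]\}$ with $d$ the surface distance on $\mathbb{S}^2$, and $d^1(\alpha,\beta)=\max\{d((\alpha(t),\dot\alpha(t)),(\beta(t),\dot\beta(t))):t\in[0,1]\}$ with $d$ here the distance in the tangent bundle $T\mathbb{S}^2$ with a Riemannian metric induced from $\mathbb{S}^2$.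
   Context: $\mathbb{S}^2\subset\mathbb{R}^3$ is the unit sphere. A $C^1$ regular parameterized curve is a $C^1$ map $\gamma:I\to\mathbb{S}^2$, $I$ a compact interval, with $\dot\gamma(t)\ne 0$ for all $t\in I$. Two such curves are identified if they differ by a $C^1$ bijective reparameterization with positive derivative; a $C^1$ regular curve is such an equivalence class and is represented by its parameterization $\gamma:[0,1]\to\mathbb{S}^2$ of constant speed $|\dot\gamma|\equiv L_\gamma$ (the length of $\gamma$). Write $\boldsymbol{t}_\gamma=\dot\gamma/|\dot\gamma|$ and $\boldsymbol{n}_\gamma=\gamma\times\boldsymbol{t}_\gamma$. The Frenet frame $\mathfrak{F}_\gamma(t)\in\mathrm{SO}_3(\mathbb{R})$ is the matrix with columns $\gamma(t),\boldsymbol{t}_\gamma(t),\boldsymbol{n}_\gamma(t)$. $\mathcal{I}(\boldsymbol{P},\boldsymbol{Q})$ is the set of all $C^1$ regular curves with $\mathfrak{F}_\gamma(0)=\boldsymbol{P}$ and $\mathfrak{F}_\gamma(1)=\boldsymbol{Q}$. If $\dot\gamma$ is Lipschitz, then in terms of arc-length $s$ the derivative $\boldsymbol{t}_\gamma'(s)$ exists for a.e. $s$, and the geodesic curvature is $\kappa(s)=\langle\boldsymbol{t}_\gamma'(s),\boldsymbol{n}_\gamma(s)\rangle$; $\kappa(t)$ means $\kappa(s(t))$. $\mathcal{P}_{\kappa_1}^{\kappa_2}(\boldsymbol{P},\boldsymbol{Q})$ is the set of all $\gamma\in\mathcal{I}(\boldsymbol{P},\boldsymbol{Q})$ such that $\dot\gamma$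 is Lipschitz continuous and $\kappa_1<\operatorname{ess\,inf}_{t\in[0,1]}\kappa(t)\le \operatorname{ess\,sup}_{t\in[0,1]}\kappa(t)<\kappa_2$. The Riemannian metric on $T\mathbb{S}^2$ induced from $\mathbb{S}^2$ may be taken to be the Sasaki metric. The paper treats $d^1$ as interchangeable with the equivalent metric $\bar d^1(\alpha,\beta)=\max_{t\in[0,1]}\{d_1(\alpha(t),\beta(t))+d_2(\dot\alpha(t),\dot\beta(t))\}$, where $d_1$ is the surface distance on $\mathbb{S}^2$ and $d_2$ the Euclidean distance on $\mathbb{R}^3$. *)

theory Defs
  imports "HOL-Analysis.Analysis" "HOL-Probability.Essential_Supremum"
begin

section \<open>Regular curves on the unit sphere\<close>

text \<open>A curve is a function on \<open>[0,1]\<close>; outside of \<open>[0,1]\<close> it takes the dummy value \<open>undefined\<close>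
  (\<^const>\<open>extensional\<close>), so that two curves are equal iff they agree on \<open>[0,1]\<close>.
  Derivatives at the endpoints are one-sided.\<close>

definition velocity :: "(real \<Rightarrow> real^3) \<Rightarrow> real \<Rightarrow> real^3" where
  "velocity \<gamma> t = vector_derivative \<gamma> (at t within {0..1})"

definition curve_length :: "(real \<Rightarrow> real^3) \<Rightarrow> real" where
  "curve_length \<gamma> = integral {0..1} (\<lambda>t. norm (velocity \<gamma> t))"

text \<open>The condition on the norm of the velocity selects, from each class of curves modulo orientation
  preserving \<open>C\<^sup>1\<close> reparameterization, its unique representative of constant speed on \<open>[0,1]\<close>.\<close>

definition C1_regular_curve :: "(real \<Rightarrow> real^3) \<Rightarrow> bool" where
  "C1_regular_curve \<gamma> \<longleftrightarrow>
     \<gamma> \<in> extensional {0..1} \<and>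
     \<gamma> ` {0..1} \<subseteq> sphere 0 1 \<and>
     \<gamma> differentiable_on {0..1} \<and>
     continuous_on {0..1} (velocity \<gamma>) \<and>
     (\<forall>t\<in>{0..1}. velocity \<gamma> t \<noteq> 0) \<and>
     (\<forall>t\<in>{0..1}. norm (velocity \<gamma> t) = curve_length \<gamma>)"

definition unit_tangent :: "(real \<Rightarrow> real^3) \<Rightarrow> real \<Rightarrow> real^3" where
  "unit_tangent \<gamma> t = velocity \<gamma> t /\<^sub>R norm (velocity \<gamma> t)"

definition unit_normal :: "(real \<Rightarrow> real^3) \<Rightarrow> real \<Rightarrow> real^3" where
  "unit_normal \<gamma> t = cross3 (\<gamma> t) (unit_tangent \<gamma> t)"

text \<open>The function \<^const>\<open>vector\<close> lists the rows of a matrix, hence the transposition.\<close>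

definition frenet_frame :: "(real \<Rightarrow> real^3) \<Rightarrow> real \<Rightarrow> real^3^3" where
  "frenet_frame \<gamma> t = transpose (vector [\<gamma> t, unit_tangent \<gamma> t, unit_normal \<gamma> t])"

definition curves_between :: "real^3^3 \<Rightarrow> real^3^3 \<Rightarrow> (real \<Rightarrow> real^3) set" where
  "curves_between P Q =
     {\<gamma>. C1_regular_curve \<gamma> \<and> frenet_frame \<gamma> 0 = P \<and> frenet_frame \<gamma> 1 = Q}"

section \<open>Geodesic curvature\<close>

text \<open>For a constant speed curve of length \<open>L\<close>, the parameter \<open>t\<close> corresponds to the arc-length
  \<open>s = L t \<in> [0,L]\<close>.\<close>

definition curvature_arclength :: "(real \<Rightarrow> real^3) \<Rightarrow> real \<Rightarrow> real" where
  "curvature_arclength \<gamma> s =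
     vector_derivative (\<lambda>u. unit_tangent \<gamma> (u / curve_length \<gamma>)) (at s within {0..curve_length \<gamma>})
       \<bullet> unit_normal \<gamma> (s / curve_length \<gamma>)"

text \<open>If the velocity is Lipschitz, the derivative above exists for almost every \<open>s\<close>. On the
  remaining null set \<^const>\<open>vector_derivative\<close> has an unspecified value, which does not affect the
  essential bounds, taken with respect to the (complete) Lebesgue measure.\<close>

definition geodesic_curvature :: "(real \<Rightarrow> real^3) \<Rightarrow> real \<Rightarrow> real" where
  "geodesic_curvature \<gamma> t = curvature_arclength \<gamma> (curve_length \<gamma> * t)"

definition essinf :: "'a measure \<Rightarrow> ('a \<Rightarrow> ereal) \<Rightarrow> ereal" where
  "essinf M f = - esssup M (\<lambda>x. - f x)"

definition curvature_bounded_curves ::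
  "real \<Rightarrow> real \<Rightarrow> real^3^3 \<Rightarrow> real^3^3 \<Rightarrow> (real \<Rightarrow> real^3) set" where
  "curvature_bounded_curves \<kappa>\<^sub>1 \<kappa>\<^sub>2 P Q =
     {\<gamma> \<in> curves_between P Q.
        (\<exists>C. C-lipschitz_on {0..1} (velocity \<gamma>)) \<and>
        ereal \<kappa>\<^sub>1 < essinf (lebesgue_on {0..1}) (\<lambda>t. ereal (geodesic_curvature \<gamma> t)) \<and>
        essinf (lebesgue_on {0..1}) (\<lambda>t. ereal (geodesic_curvature \<gamma> t))
          \<le> esssup (lebesgue_on {0..1}) (\<lambda>t. ereal (geodesic_curvature \<gamma> t)) \<and>
        esssup (lebesgue_on {0..1}) (\<lambda>t. ereal (geodesic_curvature \<gamma> t)) < ereal \<kappa>\<^sub>2}"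

section \<open>Riemannian distances on the sphere and on its tangent bundle\<close>

text \<open>Riemannian distances are infima of lengths of piecewise \<open>C\<^sup>1\<close> paths. The library's
  \<^const>\<open>valid_path\<close> allows the derivative to be unbounded near the finitely many exceptional points,
  so lengths are taken in \<open>[0,\<infinity>]\<close>; this does not change the infimum.\<close>

definition sphere_dist :: "real^3 \<Rightarrow> real^3 \<Rightarrow> ennreal" where
  "sphere_dist p q =
     (INF c \<in> {c. valid_path c \<and> path_image c \<subseteq> sphere 0 1 \<and> pathstart c = p \<and> pathfinish c = q}.
        \<integral>\<^sup>+t\<in>{0..1}. ennreal (norm (vector_derivative c (at t))) \<partial>lborel)"

definition tangent_bundle :: "((real^3) \<times> (real^3)) set" where
  "tangent_bundle = {(p, v). p \<in> sphere 0 1 \<and> v \<bullet> p = 0}"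

text \<open>The Sasaki norm of the tangent vector \<open>(p', v')\<close> to the tangent bundle at \<open>(p, v)\<close>. Along a path
  \<open>(p(t), v(t))\<close>, the orthogonal projection of \<open>v'\<close> to the tangent plane at \<open>p\<close> is the covariant
  derivative of \<open>v\<close>.\<close>

fun sasaki_norm :: "(real^3) \<times> (real^3) \<Rightarrow> (real^3) \<times> (real^3) \<Rightarrow> real" where
  "sasaki_norm (p, v) (p', v') = sqrt ((norm p')\<^sup>2 + (norm (v' - (v' \<bullet> p) *\<^sub>R p))\<^sup>2)"

definition sasaki_dist :: "(real^3) \<times> (real^3) \<Rightarrow> (real^3) \<times> (real^3) \<Rightarrow> ennreal" where
  "sasaki_dist x y =
     (INF c \<in> {c. valid_path c \<and> path_image c \<subseteq> tangent_bundle \<and> pathstart c = x \<and> pathfinish c = y}.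
        \<integral>\<^sup>+t\<in>{0..1}. ennreal (sasaki_norm (c t) (vector_derivative c (at t))) \<partial>lborel)"

text \<open>For two curves as above, the suprema below are maxima of finite continuous functions.\<close>

definition d0 :: "(real \<Rightarrow> real^3) \<Rightarrow> (real \<Rightarrow> real^3) \<Rightarrow> real" where
  "d0 \<alpha> \<beta> = enn2real (SUP t\<in>{0..1}. sphere_dist (\<alpha> t) (\<beta> t))"

definition d1 :: "(real \<Rightarrow> real^3) \<Rightarrow> (real \<Rightarrow> real^3) \<Rightarrow> real" where
  "d1 \<alpha> \<beta> =
     enn2real (SUP t\<in>{0..1}. sasaki_dist (\<alpha> t, velocity \<alpha> t) (\<beta> t, velocity \<beta> t))"

end

theory Submission
  imports Defs
begin

text \<open>The curvature bounds make the velocity of a curve of length \<open>L\<close> Lipschitz with constant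
  \<open>L\<^sup>2 C\<close>, where \<open>C\<close> depends only on \<open>\<kappa>\<^sub>1\<close> and \<open>\<kappa>\<^sub>2\<close>. A curve that is uniformly close to \<open>\<alpha>\<close> cannot
  be long: a curve with curvature at most \<open>C\<close> leaves every ball of radius much smaller than \<open>1/C\<close>
  after a length of order \<open>1/C\<close>. Hence the curves near \<open>\<alpha>\<close> have a common Lipschitz
  constant for their velocities, and by interpolation a small uniform distance of the curves forces a
  small uniform distance of the velocities. Since the curvature is only controlled almost everywhere,
  one needs Lebesgue's theorem that Lipschitz functions are differentiable almost everywhere.\<close>

section \<open>Differentiability of Lipschitz functions\<close>

text \<open>Only one of the two comparisons is hard. Projecting a path from the tangent bundle to
  the sphere never lengthens it, so \<open>d0\<close> is at most \<open>d1\<close> everywhere. The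
  converse can only be local: inserting further circles of admissible curvature makes the curves
  arbitrarily long, so no single Lipschitz constant for velocities serves the whole space. The
  radius therefore depends on the centre \<alpha>, which is enough for the topologies to agree. It
  is what permits passing from the almost everywhere bound on the acceleration to a bound on
  increments of the velocity; for merely continuous functions such as Cantor's this inference fails.
  Both distances are infima over paths. Besides the projection, two estimates give access to them:
  the chord bounds the surface distance from below, and one explicit path over a great circle bounds
  the Sasaki distance from above.\<close>

lemma emeasure_interval_measure_Ioo:
  assumes "mono F" "continuous_on UNIV F" "u \<le> (v::real)"
  shows "emeasure (interval_measure F) {u<..<v} = ennreal (F v - F u)"
proof (cases "u = v")
  case False
  have F: "\<And>x y. x \<le> y \<Longrightarrow> F x \<le> F y" using assms(1) by (auto dest: monoD)
  have 1: "emeasure (interval_measure F) {v..v} = 0"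
    by (subst emeasure_interval_measure_Icc) (use F assms in auto)
  have "\<And>a. continuous (at_right a) F"
    using assms(2) continuous_at_imp_continuous_within continuous_on_eq_continuous_at by blast
  then have "ennreal (F v - F u) = emeasure (interval_measure F) {u<..v}"
    by (subst emeasure_interval_measure_Ioc) (use F assms in auto)
  also have "{u<..v} = {u<..<v} \<union> {v..v}" using False assms by auto
  also have "emeasure (interval_measure F) \<dots> = emeasure (interval_measure F) {u<..<v}"
    using 1 by (intro emeasure_Un_null_set) auto
  finally show ?thesis by simp
qed simp

text \<open>Vitali's theorem selects countably many disjoint admissible intervals that exhaust
  \<open>S\<close> up to a null set, and the inequality for single intervals then adds up. Below,
  one measure is the Stieltjes measure of a monotone function and the other a multiple of Lebesgue
  measure, so \<open>P\<close> is a condition on slopes.\<close>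

lemma Vitali_intervals_measure_le:
  fixes P :: "real \<Rightarrow> real \<Rightarrow> bool"
  assumes "open U" "S \<subseteq> U"
    and S: "\<And>x d. x \<in> S \<Longrightarrow> 0 < d \<Longrightarrow> \<exists>u v. u < x \<and> x < v \<and> v - u < d \<and> P u v"
    and sets: "sets M = sets borel" "sets N = sets borel"
    and le: "\<And>u v. u < v \<Longrightarrow> P u v \<Longrightarrow> emeasure M {u<..<v} \<le> emeasure N {u<..<v}"
  obtains V where "open V" "V \<subseteq> U" "negligible (S - V)" "emeasure M V \<le> emeasure N V"
proof -
  \<comment> \<open>An interval is encoded as (centre, radius). The point to be covered only has to
    lie in the ball, so \<open>u\<close> and \<open>v\<close> need not be symmetric about
    \<open>x\<close>.\<close>
  define K where "K = {(c, r). 0 < r \<and> P (c - r) (c + r) \<and> ball c r \<subseteq> U}"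
  have cov: "\<exists>i. i \<in> K \<and> x \<in> ball (fst i) (snd i) \<and> snd i < d" if "x \<in> S" "0 < d" for x d
  proof -
    obtain e where e: "0 < e" "ball x e \<subseteq> U"
      using assms(1,2) \<open>x \<in> S\<close> by (meson openE subsetD)
    obtain u v where uv: "u < x" "x < v" "v - u < min d e" "P u v"
      using S[OF \<open>x \<in> S\<close>, of "min d e"] e(1) \<open>0 < d\<close> by auto
    have "ball ((u+v)/2) ((v-u)/2) = {u<..<v}"
      by (simp add: ball_eq_greaterThanLessThan field_simps)
    moreover have "{u<..<v} \<subseteq> ball x e" using uv by (auto simp: dist_real_def)
    moreover have "(u+v)/2 - (v-u)/2 = u" "(u+v)/2 + (v-u)/2 = v" by (auto simp: field_simps)
    ultimately have "((u+v)/2, (v-u)/2) \<in> K" "x \<in> ball ((u+v)/2) ((v-u)/2)"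
      using uv e unfolding K_def by auto
    moreover have "(v-u)/2 < d" using uv by auto
    ultimately show ?thesis by force
  qed
  obtain C where C: "countable C" "C \<subseteq> K"
    "pairwise (\<lambda>i j. disjnt (ball (fst i) (snd i)) (ball (fst j) (snd j))) C"
    "negligible (S - (\<Union>i\<in>C. ball (fst i) (snd i)))"
    by (rule Vitali_covering_theorem_balls[OF cov, of S])
  define V where "V = (\<Union>i\<in>C. ball (fst i) (snd i))"
  have disj: "disjoint_family_on (\<lambda>i. ball (fst i) (snd i)) C"
    using C(3) unfolding disjoint_family_on_def pairwise_def disjnt_def by auto
  have "emeasure M V = (\<integral>\<^sup>+i. emeasure M (ball (fst i) (snd i)) \<partial>count_space C)"
    unfolding V_def by (rule emeasure_UN_countable[OF _ C(1) disj]) (auto simp: sets)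
  also have "\<dots> \<le> (\<integral>\<^sup>+i. emeasure N (ball (fst i) (snd i)) \<partial>count_space C)"
  proof (rule nn_integral_mono)
    fix i assume "i \<in> space (count_space C)"
    then have "i \<in> K" using C by auto
    then show "emeasure M (ball (fst i) (snd i)) \<le> emeasure N (ball (fst i) (snd i))"
      unfolding ball_eq_greaterThanLessThan by (intro le) (auto simp: K_def)
  qed
  also have "\<dots> = emeasure N V"
    unfolding V_def by (rule emeasure_UN_countable[OF _ C(1) disj, symmetric]) (auto simp: sets)
  finally show thesis
  proof (intro that[of V])
    have "ball (fst i) (snd i) \<subseteq> U" if "i \<in> C" for i using subsetD[OF C(2) that] by (auto simp: K_def)
    then show "V \<subseteq> U" unfolding V_def by blast
  qed (use C(4) in \<open>auto simp: V_def\<close>)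
qed

text \<open>With \<open>m\<close> the outer measure of \<open>E\<close>, cover \<open>E\<close> up to a null set by disjoint intervals of slope below
  \<open>p\<close> and total length close to \<open>m\<close>, and inside these by disjoint intervals of slope above \<open>q\<close>.
  Comparing the \<open>f\<close>-measures of the two families gives \<open>q m \<le> p m\<close>.\<close>

lemma negligible_derivate_gap:
  fixes f :: "real \<Rightarrow> real"
  assumes f: "mono f" "continuous_on UNIV f" and pq: "0 \<le> p" "p < q" and E: "E \<subseteq> {a..b}"
    and low: "\<And>x d. x \<in> E \<Longrightarrow> 0 < d \<Longrightarrow> \<exists>u v. u < x \<and> x < v \<and> v - u < d \<and> f v - f u < p * (v - u)"
    and upp: "\<And>x d. x \<in> E \<Longrightarrow> 0 < d \<Longrightarrow> \<exists>u v. u < x \<and> x < v \<and> v - u < d \<and> f v - f u > q * (v - u)"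
  shows "negligible E"
proof -
  let ?M = "interval_measure f"
  \<comment> \<open>\<open>E\<close> is not known to be measurable, so \<open>m\<close> plays the
    part of its outer measure. Members of \<open>A\<close> may miss a null part of \<open>E\<close>
    because Vitali's theorem covers only up to null sets; this is what puts \<open>W\<close> into
    \<open>A\<close> below.\<close>
  define A where "A = {S \<in> sets lebesgue. negligible (E - S)}"
  define m where "m = (INF S\<in>A. emeasure lebesgue S)"
  have "{a..b} \<in> A" using E by (auto simp: A_def Diff_eq_empty_iff[THEN iffD2])
  then have "m \<le> emeasure lebesgue {a..b}" unfolding m_def by (rule INF_lower)
  also have "\<dots> < \<infinity>" by (simp add: emeasure_lborel_Icc_eq)
  finally have mfin: "m < \<infinity>" .
  have open_cover: "\<exists>U. open U \<and> E \<subseteq> U \<and> emeasure lborel U \<le> m + ennreal e" if "0 < e" for e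
  proof -
    have "m < m + ennreal (e/2)" using mfin \<open>0 < e\<close> by (simp add: ennreal_add_left_cancel_less)
    then obtain S where S: "S \<in> A" "emeasure lebesgue S < m + ennreal (e/2)"
      unfolding m_def INF_less_iff by auto
    have neg: "negligible (E - S)" and Sl: "S \<in> sets lebesgue" using S(1) by (auto simp: A_def)
    then have null: "E - S \<in> null_sets lebesgue" using negligible_iff_null_sets by blast
    then have SE: "S \<union> (E - S) \<in> sets lebesgue" using Sl by (intro sets.Un) auto
    obtain T where T: "open T" "S \<union> (E - S) \<subseteq> T" "T - (S \<union> (E - S)) \<in> lmeasurable"
      "emeasure lebesgue (T - (S \<union> (E - S))) < ennreal (e/2)"
      using sets_lebesgue_outer_open[OF SE, of "e/2"] \<open>0 < e\<close> by auto
    have "emeasure lborel T = emeasure lebesgue T" using T(1) by simp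
    also have "\<dots> = emeasure lebesgue ((T - (S \<union> (E - S))) \<union> (S \<union> (E - S)))"
      using T(2) by (intro arg_cong[where f = "emeasure lebesgue"]) auto
    also have "\<dots> \<le> emeasure lebesgue (T - (S \<union> (E - S))) + emeasure lebesgue (S \<union> (E - S))"
      using T(3) SE by (intro emeasure_subadditive) (auto simp: fmeasurable_def)
    also have "emeasure lebesgue (S \<union> (E - S)) = emeasure lebesgue S"
      by (rule emeasure_Un_null_set[OF Sl null])
    also have "emeasure lebesgue (T - (S \<union> (E - S))) + emeasure lebesgue S \<le> ennreal (e/2) + (m + ennreal (e/2))"
      using T(4) S(2) by (intro add_mono) auto
    also have "\<dots> = m + ennreal e"
      using \<open>0 < e\<close> by (subst add.left_commute, subst ennreal_plus[symmetric]) auto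
    finally show ?thesis using T by auto
  qed
  have key: "ennreal q * m \<le> ennreal p * (m + ennreal e)" if "0 < e" for e
  proof -
    obtain U where U: "open U" "E \<subseteq> U" "emeasure lborel U \<le> m + ennreal e" using open_cover[OF \<open>0 < e\<close>] by auto
    obtain V where V: "open V" "V \<subseteq> U" "negligible (E - V)"
      "emeasure ?M V \<le> emeasure (scale_measure (ennreal p) lborel) V"
    proof (rule Vitali_intervals_measure_le[OF U(1,2) low, of ?M "scale_measure (ennreal p) lborel"])
      fix u v assume "u < v" "f v - f u < p * (v - u)"
      then show "emeasure ?M {u<..<v} \<le> emeasure (scale_measure (ennreal p) lborel) {u<..<v}"
        using pq by (simp add: emeasure_interval_measure_Ioo[OF f] ennreal_mult[symmetric] ennreal_leI)
    qed auto
    \<comment> \<open>The second family has to stay inside \<open>V\<close>, so it covers only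
      \<open>E \<inter> V\<close>; the lost part \<open>E - V\<close> is null.\<close>
    obtain W where W: "open W" "W \<subseteq> V" "negligible ((E \<inter> V) - W)"
      "emeasure (scale_measure (ennreal q) lborel) W \<le> emeasure ?M W"
    proof (rule Vitali_intervals_measure_le[OF V(1) Int_lower2[of E V], of "\<lambda>u v. f v - f u > q * (v - u)" "scale_measure (ennreal q) lborel" ?M])
      fix u v assume "u < v" "f v - f u > q * (v - u)"
      then show "emeasure (scale_measure (ennreal q) lborel) {u<..<v} \<le> emeasure ?M {u<..<v}"
        using pq by (simp add: emeasure_interval_measure_Ioo[OF f] ennreal_mult[symmetric] ennreal_leI)
    qed (use upp in auto)
    have "negligible (E - W)"
      by (rule negligible_subset[OF negligible_Un[OF V(3) W(3)]]) auto
    then have "W \<in> A" using W(1) by (auto simp: A_def)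
    then have "m \<le> emeasure lebesgue W" unfolding m_def by (rule INF_lower)
    then have "m \<le> emeasure lborel W" using W(1) by simp
    then have "ennreal q * m \<le> ennreal q * emeasure lborel W" by (rule mult_left_mono) simp
    also have "\<dots> \<le> emeasure ?M W" using W by simp
    also have "\<dots> \<le> emeasure ?M V" using W V by (intro emeasure_mono) auto
    also have "\<dots> \<le> ennreal p * emeasure lborel V" using V by simp
    also have "\<dots> \<le> ennreal p * emeasure lborel U" using V U by (intro mult_left_mono emeasure_mono) auto
    also have "\<dots> \<le> ennreal p * (m + ennreal e)" using U by (intro mult_left_mono) auto
    finally show ?thesis .
  qed
  have "m = 0"
  proof -
    obtain r where r: "0 \<le> r" "m = ennreal r" using mfin by (cases m) auto
    have "q * r \<le> p * r + e" if "0 < e" for e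
    proof -
      \<comment> \<open>Since \<open>p\<close> may be zero, the error is divided by
        \<open>p + 1\<close>; then \<open>p * (e / (p+1))\<close> is at most
        \<open>e\<close>.\<close>
      have "0 < e / (p+1)" using that pq by auto
      from key[OF this] have "ennreal (q * r) \<le> ennreal (p * (r + e/(p+1)))"
        using r pq that by (simp add: ennreal_mult[symmetric] flip: ennreal_plus)
      then have "q * r \<le> p * (r + e/(p+1))" using r pq that by (subst (asm) ennreal_le_iff) auto
      also have "\<dots> \<le> p * r + e" using pq that by (simp add: field_simps)
      finally show ?thesis .
    qed
    then have "q * r \<le> p * r" by (rule field_le_epsilon)
    then have "r = 0" using r pq by (smt (verit) mult_right_mono mult_strict_right_mono)
    then show ?thesis using r by simp
  qed
  show ?thesis unfolding negligible_outer
  proof (intro allI impI)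
    fix e :: real assume "0 < e"
    then obtain U where U: "open U" "E \<subseteq> U" "emeasure lborel U \<le> m + ennreal (e/2)"
      using open_cover[of "e/2"] by auto
    then have le: "emeasure lebesgue U \<le> ennreal (e/2)" using \<open>m = 0\<close> by simp
    then have "U \<in> lmeasurable" using U(1) by (intro fmeasurableI) (auto intro: le_less_trans)
    moreover have "measure lebesgue U \<le> e/2" using le \<open>0 < e\<close> unfolding measure_def by (intro enn2real_leI) auto
    ultimately show "\<exists>T. E \<subseteq> T \<and> T \<in> lmeasurable \<and> measure lebesgue T < e"
      using U \<open>0 < e\<close> by (intro exI[of _ U]) auto
  qed
qed

text \<open>Where differentiability fails, slopes over short intervals around the point fall below
  one rational and exceed a larger one infinitely often as the intervals shrink. Countably many
  pairs of rationals occur, and each pair contributes a null set by the preceding lemma. The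
  Lipschitz bound keeps the derivative finite.\<close>

lemma mono_Lipschitz_differentiable_ae:
  fixes f :: "real \<Rightarrow> real"
  assumes f: "mono f" and L: "L-lipschitz_on UNIV f"
  shows "negligible {x \<in> {a..b}. \<not> f differentiable (at x)}"
proof -
  have cont: "continuous_on UNIV f" by (rule lipschitz_on_continuous_on[OF L])
  \<comment> \<open>These slopes belong to intervals with \<open>x\<close> strictly inside, the form
    that suits the covering argument. Difference quotients based at \<open>x\<close> itself are
    recovered at the end by continuity.\<close>
  define lowP where "lowP p x \<longleftrightarrow> (\<forall>d>0. \<exists>u v. u < x \<and> x < v \<and> v - u < d \<and> f v - f u < p * (v - u))" for p x
  define uppP where "uppP q x \<longleftrightarrow> (\<forall>d>0. \<exists>u v. u < x \<and> x < v \<and> v - u < d \<and> f v - f u > q * (v - u))" for q x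
  define E where "E = (\<lambda>(p, q). {x \<in> {a..b}. lowP (of_rat p) x \<and> uppP (of_rat q) x})"
  define I where "I = {(p::rat, q::rat). p < q}"
  have neg: "negligible (E i)" if "i \<in> I" for i
  proof -
    obtain p q where i: "i = (p, q)" "p < q" using \<open>i \<in> I\<close> by (auto simp: I_def)
    show ?thesis
    proof (cases "0 \<le> p")
      case True
      show ?thesis
        by (rule negligible_derivate_gap[OF f cont, of "of_rat p" "of_rat q" _ a b])
          (use i True in \<open>auto simp: E_def lowP_def uppP_def of_rat_less\<close>)
    next
      case False
      have "\<not> lowP (of_rat p) x" for x
      proof
        assume "lowP (of_rat p) x"
        then have "\<exists>u v. u < x \<and> x < v \<and> v - u < 1 \<and> f v - f u < of_rat p * (v - u)"
          unfolding lowP_def by (elim allE[of _ 1]) simp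
        then obtain u v where uv: "u < x" "x < v" "f v - f u < of_rat p * (v - u)" by blast
        have "of_rat p * (v - u) \<le> 0" using False uv by (intro mult_nonpos_nonneg) auto
        moreover have "f u \<le> f v" using monoD[OF f, of u v] uv by simp
        ultimately show False using uv by linarith
      qed
      then show ?thesis by (simp add: E_def i)
    qed
  qed
  have "negligible (\<Union>i\<in>I. E i)"
  proof (rule negligible_countable_Union)
    have "countable I" by (rule countable_subset[OF subset_UNIV]) simp
    then show "countable (E ` I)" by simp
  qed (use neg in auto)
  moreover have "f differentiable (at x)" if x: "x \<in> {a..b}" "x \<notin> (\<Union>i\<in>I. E i)" for x
  proof -
    have alt: "\<not> lowP (of_rat p) x \<or> \<not> uppP (of_rat q) x" if "p < q" for p q
      using x that by (auto simp: E_def I_def)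
    have Lb: "f v - f u \<le> L * (v - u)" if "u < v" for u v
      using lipschitz_onD[OF L, of v u] that by (auto simp: dist_real_def)
    \<comment> \<open>\<open>A\<close> consists of the lower bounds for the slopes of all
      sufficiently short intervals around \<open>x\<close>. Its supremum \<open>l\<close> is the
      lower derivate and will be the derivative.\<close>
    define A where "A = {r. \<not> lowP r x}"
    have A0: "0 \<in> A"
    proof -
      have "\<not> (f v - f u < 0 * (v - u))" if "u < x" "x < v" for u v
        using monoD[OF f, of u v] that by simp
      then show ?thesis unfolding A_def lowP_def mem_Collect_eq by (auto intro: exI[of _ 1])
    qed
    have A_le: "r \<le> L" if "r \<in> A" for r
    proof -
      obtain d where d: "d > 0" "\<And>u v. u < x \<Longrightarrow> x < v \<Longrightarrow> v - u < d \<Longrightarrow> \<not> f v - f u < r * (v - u)"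
        using \<open>r \<in> A\<close> by (auto simp: A_def lowP_def)
      have "\<not> f (x + d/4) - f (x - d/4) < r * (x + d/4 - (x - d/4))"
        by (rule d(2)) (use \<open>d > 0\<close> in auto)
      then have "r * (x + d/4 - (x - d/4)) \<le> L * (x + d/4 - (x - d/4))"
        using Lb[of "x - d/4" "x + d/4"] \<open>d > 0\<close> by linarith
      then show ?thesis using \<open>d > 0\<close> by (simp add: mult_le_cancel_right)
    qed
    define l where "l = Sup A"
    have bdd: "bdd_above A" using A_le by (auto simp: bdd_above_def)
    have low: "\<exists>d>0. \<forall>u v. u < x \<and> x < v \<and> v - u < d \<longrightarrow> f v - f u \<ge> (l - e) * (v - u)" if "0 < e" for e
    proof -
      have "l - e < Sup A" using that by (simp add: l_def)
      then obtain r where r: "r \<in> A" "l - e < r" using less_cSup_iff[OF _ bdd] A0 by auto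
      obtain d where d: "d > 0" "\<And>u v. u < x \<Longrightarrow> x < v \<Longrightarrow> v - u < d \<Longrightarrow> \<not> f v - f u < r * (v - u)"
        using \<open>r \<in> A\<close> by (auto simp: A_def lowP_def)
      have "(l - e) * (v - u) \<le> f v - f u" if "u < x" "x < v" "v - u < d" for u v
      proof -
        have "(l - e) * (v - u) \<le> r * (v - u)" using r that by (intro mult_right_mono) auto
        then show ?thesis using d(2)[OF that] by linarith
      qed
      then show ?thesis using d(1) by blast
    qed
    have upp: "\<exists>d>0. \<forall>u v. u < x \<and> x < v \<and> v - u < d \<longrightarrow> f v - f u \<le> (l + e) * (v - u)" if "0 < e" for e
    proof -
      \<comment> \<open>As \<open>p\<close> exceeds \<open>l\<close>, slopes below \<open>p\<close>
        occur at every scale. Since \<open>x\<close> avoids the set \<open>E (p, q)\<close>, slopes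
        above \<open>q\<close> cannot, and \<open>q\<close> is below \<open>l + e\<close>.\<close>
      obtain p :: rat where p: "l < of_rat p" "of_rat p < l + e/2" using of_rat_dense[of l "l + e/2"] \<open>0 < e\<close> by auto
      obtain q :: rat where q: "l + e/2 < of_rat q" "of_rat q < l + e" using of_rat_dense[of "l + e/2" "l + e"] \<open>0 < e\<close> by auto
      have "(of_rat p :: real) < of_rat q" using p q by linarith
      then have "p < q" by (simp add: of_rat_less)
      have "of_rat p \<notin> A" using p(1) cSup_upper[OF _ bdd] unfolding l_def by (meson not_le)
      then have "\<not> uppP (of_rat q) x" using alt[OF \<open>p < q\<close>] by (auto simp: A_def)
      then obtain d where d: "d > 0" "\<And>u v. u < x \<Longrightarrow> x < v \<Longrightarrow> v - u < d \<Longrightarrow> \<not> f v - f u > of_rat q * (v - u)"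
        by (auto simp: uppP_def)
      have "f v - f u \<le> (l + e) * (v - u)" if "u < x" "x < v" "v - u < d" for u v
      proof -
        have "of_rat q * (v - u) \<le> (l + e) * (v - u)" using q that by (intro mult_right_mono) auto
        then show ?thesis using d(2)[OF that] by linarith
      qed
      then show ?thesis using d(1) by blast
    qed
    have "(f has_derivative (\<lambda>h. h * l)) (at x)"
      unfolding has_derivative_at_alt
    proof (intro conjI allI impI)
      fix e :: real assume "0 < e"
      obtain d1 where d1: "d1 > 0" "\<And>u v. u < x \<Longrightarrow> x < v \<Longrightarrow> v - u < d1 \<Longrightarrow> f v - f u \<ge> (l - e) * (v - u)"
        using low[OF \<open>0 < e\<close>] by blast
      obtain d2 where d2: "d2 > 0" "\<And>u v. u < x \<Longrightarrow> x < v \<Longrightarrow> v - u < d2 \<Longrightarrow> f v - f u \<le> (l + e) * (v - u)"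
        using upp[OF \<open>0 < e\<close>] by blast
      define d where "d = min d1 d2"
      have "d > 0" using d1 d2 by (simp add: d_def)
      have isc: "isCont f x" using cont continuous_on_eq_continuous_at by blast
      \<comment> \<open>The bounds \<open>d1\<close> and \<open>d2\<close> need an endpoint strictly
        on the other side of \<open>x\<close>; that endpoint is then sent to
        \<open>x\<close>.\<close>
      have right: "\<bar>f y - f x - (y - x) * l\<bar> \<le> e * (y - x)" if "x < y" "y - x < d" for y
      proof -
        have ev: "\<forall>\<^sub>F u in at_left x. u < x \<and> y - u < d"
          using that by (auto intro!: exI[of _ "y - d"] simp: eventually_at_left_field)
        have t: "((\<lambda>u. f y - f u - (y - u) * l) \<longlongrightarrow> f y - f x - (y - x) * l) (at_left x)"
          using isc by (intro tendsto_intros) (simp_all add: isCont_def filterlim_at_split)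
        have s: "((\<lambda>u. e * (y - u)) \<longlongrightarrow> e * (y - x)) (at_left x)" by (intro tendsto_intros)
        have "\<forall>\<^sub>F u in at_left x. \<bar>f y - f u - (y - u) * l\<bar> \<le> e * (y - u)"
          using ev
        proof eventually_elim
          case (elim u)
          then show ?case using d1(2)[of u y] d2(2)[of u y] that by (auto simp: d_def algebra_simps abs_le_iff)
        qed
        then show ?thesis by (intro tendsto_le[OF _ s tendsto_rabs[OF t]]) auto
      qed
      have left: "\<bar>f x - f y - (x - y) * l\<bar> \<le> e * (x - y)" if "y < x" "x - y < d" for y
      proof -
        have ev: "\<forall>\<^sub>F u in at_right x. x < u \<and> u - y < d"
          using that by (auto intro!: exI[of _ "y + d"] simp: eventually_at_right_field)
        have t: "((\<lambda>u. f u - f y - (u - y) * l) \<longlongrightarrow> f x - f y - (x - y) * l) (at_right x)"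
          using isc by (intro tendsto_intros) (simp_all add: isCont_def filterlim_at_split)
        have s: "((\<lambda>u. e * (u - y)) \<longlongrightarrow> e * (x - y)) (at_right x)" by (intro tendsto_intros)
        have "\<forall>\<^sub>F u in at_right x. \<bar>f u - f y - (u - y) * l\<bar> \<le> e * (u - y)"
          using ev
        proof eventually_elim
          case (elim u)
          then show ?case using d1(2)[of y u] d2(2)[of y u] that by (auto simp: d_def algebra_simps abs_le_iff)
        qed
        then show ?thesis by (intro tendsto_le[OF _ s tendsto_rabs[OF t]]) auto
      qed
      have "norm (f y - f x - (y - x) * l) \<le> e * norm (y - x)" if "norm (y - x) < d" for y
        using right[of y] left[of y] that by (cases y x rule: linorder_cases) (auto simp: abs_if algebra_simps split: if_splits)
      then show "\<exists>d>0. \<forall>y. norm (y - x) < d \<longrightarrow> norm (f y - f x - (y - x) * l) \<le> e * norm (y - x)"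
        using \<open>d > 0\<close> by blast
    qed (rule bounded_linear_mult_left)
    then show ?thesis by (auto simp: differentiable_def)
  qed
  ultimately show ?thesis by (elim negligible_subset) auto
qed

text \<open>Adding \<open>L * x\<close> to a coordinate of an \<open>L\<close>-Lipschitz function
  makes it monotone. The clamp \<open>c\<close> extends \<open>f\<close> to the line without
  increasing the Lipschitz constant; if it creates a kink at \<open>a\<close> or \<open>b\<close>,
  that point merely joins the null set.\<close>

lemma Lipschitz_differentiable_ae:
  fixes f :: "real \<Rightarrow> 'a::euclidean_space"
  assumes L: "L-lipschitz_on {a..b} f"
  shows "negligible {x \<in> {a..b}. \<not> f differentiable (at x within {a..b})}"
proof (cases "a \<le> b")
  case True
  define c where "c x = max a (min b x)" for x
  have c: "c x \<in> {a..b}" "dist (c x) (c y) \<le> dist x y" "x \<in> {a..b} \<Longrightarrow> c x = x" for x y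
    using True by (auto simp: c_def dist_real_def)
  have L0: "0 \<le> L" using L by (rule lipschitz_on_nonneg)
  define g where "g i x = f (c x) \<bullet> i + L * x" for i x
  have gL: "\<bar>f (c x) \<bullet> i - f (c y) \<bullet> i\<bar> \<le> L * \<bar>x - y\<bar>" if "i \<in> Basis" for i x y
  proof -
    have "\<bar>(f (c x) - f (c y)) \<bullet> i\<bar> \<le> norm (f (c x) - f (c y))" using that by (rule Basis_le_norm)
    also have "\<dots> \<le> L * dist (c x) (c y)" using lipschitz_onD[OF L] c(1) by (metis dist_norm)
    also have "\<dots> \<le> L * \<bar>x - y\<bar>" using c(2)[of x y] L0 by (intro mult_left_mono) (auto simp: dist_real_def)
    finally show ?thesis by (simp add: inner_diff_left)
  qed
  have neg: "negligible {x \<in> {a..b}. \<not> g i differentiable (at x)}" if "i \<in> Basis" for i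
  proof (rule mono_Lipschitz_differentiable_ae)
    show "mono (g i)"
    proof (rule monoI)
      fix x y :: real assume "x \<le> y"
      then show "g i x \<le> g i y" using gL[OF that, of x y] by (auto simp: g_def abs_if algebra_simps split: if_splits)
    qed
    show "(2 * L)-lipschitz_on UNIV (g i)"
    proof (rule lipschitz_onI)
      fix x y :: real
      have "g i x - g i y = (f (c x) \<bullet> i - f (c y) \<bullet> i) + L * (x - y)" by (simp add: g_def algebra_simps)
      moreover have "\<bar>L * (x - y)\<bar> = L * \<bar>x - y\<bar>" using L0 by (simp add: abs_mult)
      ultimately show "dist (g i x) (g i y) \<le> 2 * L * dist x y"
        using gL[OF that, of x y] unfolding dist_real_def by linarith
    qed (use L0 in auto)
  qed
  have "negligible (\<Union>i\<in>Basis. {x \<in> {a..b}. \<not> g i differentiable (at x)})"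
    using neg by (intro negligible_Union) auto
  moreover have "f differentiable (at x within {a..b})"
    if x: "x \<in> {a..b}" and g: "\<And>i. i \<in> Basis \<Longrightarrow> g i differentiable (at x)" for x
  proof -
    have "(\<lambda>y. f y \<bullet> i) differentiable (at x within {a..b})" if "i \<in> Basis" for i
    proof -
      have "(\<lambda>y. g i y - L * y) differentiable (at x within {a..b})"
        using g[OF that] by (intro derivative_intros) (auto intro: differentiable_at_withinI)
      then show ?thesis
        by (rule differentiable_transform_within[where d = 1]) (use x c in \<open>auto simp: g_def\<close>)
    qed
    then show ?thesis by (subst differentiable_componentwise_within) auto
  qed
  ultimately show ?thesis by (elim negligible_subset) auto
qed simp

section \<open>A mean value inequality with an almost everywhere bound on the derivative\<close>

text \<open>In a fine tagged division, the intervals tagged in \<open>N\<close> lie in an open set of small measure, so by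
  the Lipschitz condition their contribution is small.\<close>

lemma Lipschitz_ae_derivative_bound:
  fixes f :: "real \<Rightarrow> 'a::real_normed_vector"
  assumes L: "L-lipschitz_on {a..b} f" and N: "negligible N"
    and f': "\<And>x. x \<in> {a..b} - N \<Longrightarrow> (f has_vector_derivative f' x) (at x within {a..b})"
    and C: "\<And>x. x \<in> {a..b} - N \<Longrightarrow> norm (f' x) \<le> C" and "a \<le> b" "0 \<le> C"
  shows "norm (f b - f a) \<le> C * (b - a)"
proof (rule field_le_epsilon)
  fix e0 :: real assume "0 < e0"
  have L0: "0 \<le> L" using L by (rule lipschitz_on_nonneg)
  \<comment> \<open>The error will be \<open>e * (b - a)\<close> from tags outside \<open>N\<close>
    plus \<open>L * e\<close> from tags in \<open>N\<close>; the summand 1 keeps the denominator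
    positive.\<close>
  define e where "e = e0 / (b - a + L + 1)"
  have "0 < e" using \<open>0 < e0\<close> \<open>a \<le> b\<close> L0 by (simp add: e_def)
  moreover have "e * (b - a + L + 1) = e0" using \<open>a \<le> b\<close> L0 by (simp add: e_def)
  ultimately have e: "0 < e" "e * (b - a) + L * e \<le> e0" by (auto simp: algebra_simps)
  obtain U where U: "open U" "N \<subseteq> U" "U \<in> lmeasurable" "measure lebesgue U < e"
  proof -
    have Nl: "N \<in> lmeasurable" "measure lebesgue N = 0"
      using N by (auto simp: negligible_imp_measurable negligible_imp_measure0)
    obtain T where T: "open T" "N \<subseteq> T" "T - N \<in> lmeasurable" "emeasure lebesgue (T - N) < ennreal e"
      using sets_lebesgue_outer_open[of N e] Nl(1) e(1) by auto
    have "measure lebesgue (T - N) < e"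
      using T(3,4) e(1) by (simp add: emeasure_eq_measure2 ennreal_less_iff)
    moreover have "T = (T - N) \<union> N" using T by auto
    moreover have "measure lebesgue ((T - N) \<union> N) \<le> measure lebesgue (T - N) + measure lebesgue N"
      using T Nl by (intro measure_Un_le) auto
    moreover have "(T - N) \<union> N \<in> lmeasurable" using T Nl by (intro fmeasurable.Un)
    ultimately show ?thesis using that[of T] T Nl by auto
  qed
  have "\<exists>d>0. \<forall>y\<in>{a..b}. dist y x < d \<longrightarrow> norm (f y - f x - (y - x) *\<^sub>R f' x) \<le> e * \<bar>y - x\<bar>"
    if "x \<in> {a..b} - N" for x
    using f'[OF that] e(1) unfolding has_vector_derivative_def has_derivative_within_alt
    by (metis dist_norm real_norm_def)
  then obtain \<delta> where \<delta>: "\<And>x. x \<in> {a..b} - N \<Longrightarrow> 0 < \<delta> x"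
    "\<And>x y. x \<in> {a..b} - N \<Longrightarrow> y \<in> {a..b} \<Longrightarrow> dist y x < \<delta> x \<Longrightarrow> norm (f y - f x - (y - x) *\<^sub>R f' x) \<le> e * \<bar>y - x\<bar>"
    by metis
  \<comment> \<open>Tags lie in \<open>{a..b}\<close>, so the last case only serves to make \<gamma>
    a gauge on the whole line.\<close>
  define \<gamma> where "\<gamma> x = (if x \<in> N then U else if x \<in> {a..b} then ball x (\<delta> x) else ball x 1)" for x
  have "gauge \<gamma>" unfolding gauge_def \<gamma>_def using U \<delta>(1) by auto
  then obtain p where p: "p tagged_division_of {a..b}" "\<gamma> fine p"
    by (rule fine_division_exists_real)
  have fin: "finite p" using p by auto
  let ?len = "\<lambda>(x::real, k). measure lborel k"
  let ?R = "\<lambda>(x::real, k). if x \<in> N then L * measure lborel k else 0"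
  have bound: "norm (case t of (x, k) \<Rightarrow> f (Sup k) - f (Inf k)) \<le> (C + e) * ?len t + ?R t" if t: "t \<in> p" for t
  proof -
    obtain x k where xk: "t = (x, k)" by force
    obtain u v where k: "k = {u..v}"
      using tagged_division_ofD(4)[OF p(1), of x k] t xk by (metis box_real(2))
    have "x \<in> k" "k \<subseteq> {a..b}" using tagged_division_ofD(2,3)[OF p(1), of x k] t xk by auto
    then have uv: "u \<le> x" "x \<le> v" "a \<le> u" "v \<le> b" using k by auto
    have eq: "Sup k = v" "Inf k = u" "measure lborel k = v - u" using uv by (auto simp: k)
    show ?thesis
    proof (cases "x \<in> N")
      case True
      have "norm (f v - f u) \<le> L * (v - u)"
        using lipschitz_onD[OF L, of v u] uv by (auto simp: dist_norm)
      moreover have "0 \<le> (C + e) * (v - u)" using uv e \<open>0 \<le> C\<close> by auto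
      ultimately show ?thesis by (simp add: xk eq True)
    next
      case False
      have xN: "x \<in> {a..b} - N" using False uv by auto
      have "k \<subseteq> \<gamma> x" using p(2) t xk by (auto simp: fine_def)
      then have sub: "k \<subseteq> ball x (\<delta> x)" using xN by (simp add: \<gamma>_def)
      then have "dist u x < \<delta> x" "dist v x < \<delta> x" using uv k by (auto simp: dist_commute subset_iff)
      then have 1: "norm (f v - f x - (v - x) *\<^sub>R f' x) \<le> e * (v - x)"
        and 2: "norm (f u - f x - (u - x) *\<^sub>R f' x) \<le> e * (x - u)"
        using \<delta>(2)[OF xN, of v] \<delta>(2)[OF xN, of u] uv by auto
      \<comment> \<open>Both endpoints are compared through the tag between them, so the two errors
        add up to \<open>e * (v - u)\<close>.\<close>
      have "f v - f u = (f v - f x - (v - x) *\<^sub>R f' x) - (f u - f x - (u - x) *\<^sub>R f' x) + (v - u) *\<^sub>R f' x"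
        by (simp add: algebra_simps)
      then have "norm (f v - f u) \<le> e * (v - x) + e * (x - u) + norm ((v - u) *\<^sub>R f' x)"
        using 1 2 by (smt (verit) norm_triangle_ineq norm_triangle_ineq4)
      also have "norm ((v - u) *\<^sub>R f' x) \<le> (v - u) * C" using C[OF xN] uv by (simp add: mult_left_mono)
      finally show ?thesis using False by (simp add: xk eq algebra_simps)
    qed
  qed
  have sumlen: "(\<Sum>t\<in>p. ?len t) = b - a"
    using additive_content_tagged_division[of p a b] p(1) \<open>a \<le> b\<close> by (simp add: box_real)
  have sumR: "(\<Sum>t\<in>p. ?R t) \<le> L * e"
  proof -
    define q where "q = {t \<in> p. fst t \<in> N}"
    have q: "q tagged_division_of (\<Union>(snd ` q))"
      by (rule tagged_partial_division_of_Union_self) (use tagged_division_of_def p(1) q_def in \<open>auto intro: tagged_partial_division_subset\<close>)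
    have "(\<Sum>t\<in>p. ?R t) = (\<Sum>t\<in>q. L * ?len t)"
      unfolding q_def using fin by (subst sum.inter_filter) (auto intro!: sum.cong split: prod.splits)
    also have "\<dots> = L * (\<Sum>t\<in>q. ?len t)" by (simp add: sum_distrib_left)
    \<comment> \<open>Different tags can share an interval only if it is degenerate, and such
      intervals have length zero.\<close>
    also have "(\<Sum>t\<in>q. ?len t) = (\<Sum>k\<in>snd ` q. measure lborel k)"
      by (rule sum.over_tagged_division_lemma[OF q]) (simp add: content_eq_0_interior interior_cbox)
    also have "\<dots> = (\<Sum>k\<in>snd ` q. measure lebesgue k)"
      using division_ofD(4)[OF division_of_tagged_division[OF q]] by (intro sum.cong) fastforce+
    also have "\<dots> = measure lebesgue (\<Union>(snd ` q))"
      by (rule content_division[OF division_of_tagged_division[OF q]])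
    also have "measure lebesgue (\<Union>(snd ` q)) \<le> measure lebesgue U"
    proof (rule measure_mono_fmeasurable)
      have "k \<subseteq> U" if "(x, k) \<in> q" for x k
      proof -
        have "k \<subseteq> \<gamma> x" using p(2) that by (auto simp: fine_def q_def)
        then show ?thesis using that by (simp add: \<gamma>_def q_def)
      qed
      then show "\<Union>(snd ` q) \<subseteq> U" by fastforce
    qed (use U lmeasurable_division[OF division_of_tagged_division[OF q]] in auto)
    finally show ?thesis using U L0 by (meson less_imp_le mult_left_mono order_trans)
  qed
  have "f b - f a = (\<Sum>(x, k)\<in>p. f (Sup k) - f (Inf k))"
    using additive_tagged_division_1[OF \<open>a \<le> b\<close> p(1), of f] by simp
  also have "norm \<dots> \<le> (\<Sum>t\<in>p. (C + e) * ?len t + ?R t)"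
    by (rule sum_norm_le) (use bound in auto)
  also have "\<dots> = (C + e) * (b - a) + (\<Sum>t\<in>p. ?R t)"
    by (simp add: sum.distrib sum_distrib_left[symmetric] sumlen)
  also have "\<dots> \<le> C * (b - a) + e0" using sumR e(2) by (simp add: algebra_simps)
  finally show "norm (f b - f a) \<le> C * (b - a) + e0" .
qed

section \<open>Path metrics\<close>

text \<open>Choose members within \<open>e/2\<close> of each infimum. This is the passage to infima
  in the triangle inequality for path distances.\<close>

lemma le_INF_add_INF:
  fixes m :: ennreal
  assumes "\<And>a b. a \<in> A \<Longrightarrow> b \<in> B \<Longrightarrow> m \<le> f a + g b"
  shows "m \<le> (INF a\<in>A. f a) + (INF b\<in>B. g b)"
proof (rule ennreal_le_epsilon)
  fix e :: real
  assume fin: "(INF a\<in>A. f a) + (INF b\<in>B. g b) < top" and "0 < e"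
  have lt: "x < x + ennreal (e/2)" if "x < top" for x
    using that \<open>0 < e\<close> by (simp add: ennreal_add_left_cancel_less)
  have "(INF a\<in>A. f a) < top" "(INF b\<in>B. g b) < top" using fin by simp_all
  note lt[OF this(1)] lt[OF this(2)]
  then obtain a b where ab: "a \<in> A" "b \<in> B" "f a < (INF a\<in>A. f a) + ennreal (e/2)" "g b < (INF b\<in>B. g b) + ennreal (e/2)"
    unfolding INF_less_iff by blast
  have "m \<le> f a + g b" using assms ab by blast
  also have "\<dots> \<le> ((INF a\<in>A. f a) + ennreal (e/2)) + ((INF b\<in>B. g b) + ennreal (e/2))"
    using ab by (intro add_mono) auto
  also have "\<dots> = (INF a\<in>A. f a) + (INF b\<in>B. g b) + (ennreal (e/2) + ennreal (e/2))" by (simp add: ac_simps)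
  also have "ennreal (e/2) + ennreal (e/2) = ennreal e" using \<open>0 < e\<close> by (simp flip: ennreal_plus)
  finally show "m \<le> (INF a\<in>A. f a) + (INF b\<in>B. g b) + ennreal e" .
qed

text \<open>The endpoints are put into \<open>X\<close> because the derivatives are two-sided and at
  0 and 1 would depend on values of \<open>c\<close> outside the unit interval.\<close>

lemma valid_path_differentiable:
  assumes "valid_path c"
  obtains X where "finite X" "0 \<in> X" "1 \<in> X" "continuous_on {0..1} c"
    "\<And>t. t \<in> {0..1} - X \<Longrightarrow> (c has_vector_derivative vector_derivative c (at t)) (at t)"
    "continuous_on ({0..1} - X) (\<lambda>t. vector_derivative c (at t))"
proof -
  obtain X where X: "finite X" "c C1_differentiable_on {0..1} - X" "continuous_on {0..1} c"
    using assms unfolding valid_path_def piecewise_C1_differentiable_on_def by blast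
  then have "\<And>t. t \<in> {0..1} - X \<Longrightarrow> c differentiable (at t)"
    "continuous_on ({0..1} - X) (\<lambda>t. vector_derivative c (at t))"
    by (auto simp: C1_differentiable_on_eq)
  then show thesis using X
    by (intro that[of "X \<union> {0,1}"]) (auto simp: vector_derivative_works[symmetric] elim!: continuous_on_subset)
qed

text \<open>The integrand is continuous off a finite set. A vector-valued \<open>G\<close> lets the
  result serve both for the speed and for the derivative itself.\<close>

lemma valid_path_speed_measurable:
  fixes G :: "'a::real_normed_vector \<Rightarrow> 'a \<Rightarrow> 'b::{second_countable_topology, real_normed_vector}"
  assumes "valid_path c" and G: "continuous_on UNIV (\<lambda>(x, v). G x v)"
  shows "(\<lambda>t. indicator {0..1} t *\<^sub>R G (c t) (vector_derivative c (at t))) \<in> borel_measurable borel"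
proof -
  obtain X where X: "finite X" "0 \<in> X" "1 \<in> X" "continuous_on {0..1} c"
    "continuous_on ({0..1} - X) (\<lambda>t. vector_derivative c (at t))"
    using valid_path_differentiable[OF assms(1)] by metis
  have "continuous_on ({0..1} - X) (\<lambda>t. (\<lambda>(x, v). G x v) (c t, vector_derivative c (at t)))"
    using X by (intro continuous_on_compose2[OF G] continuous_on_Pair) (auto elim: continuous_on_subset)
  then have "(\<lambda>t. indicator ({0..1} - X) t *\<^sub>R G (c t) (vector_derivative c (at t))) \<in> borel_measurable borel"
    using finite_imp_closed[OF X(1)] by (intro borel_measurable_continuous_on_indicator sets.Diff) auto
  then show ?thesis
    by (rule measurable_discrete_difference[where X = X])
      (use X(1) in \<open>auto simp: countable_finite indicator_def\<close>)
qed

lemma AE_lborel_finite: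
  assumes "finite X" "\<And>t::real. t \<notin> X \<Longrightarrow> P t"
  shows "AE t in lborel. P t"
  by (rule AE_I'[OF finite_imp_null_set_lborel[OF assms(1)]]) (use assms(2) in auto)

text \<open>Common form of the integrals in \<open>sphere_dist\<close> and
  \<open>sasaki_dist\<close>, with \<open>N x v\<close> the norm of the tangent vector
  \<open>v\<close> at \<open>x\<close>. Symmetry and the triangle inequality are thus proved once
  for both.\<close>

definition path_length :: "('a \<Rightarrow> 'a \<Rightarrow> real) \<Rightarrow> (real \<Rightarrow> 'a::real_normed_vector) \<Rightarrow> ennreal" where
  "path_length N c = (\<integral>\<^sup>+t\<in>{0..1}. ennreal (N (c t) (vector_derivative c (at t))) \<partial>lborel)"

definition paths_in :: "'a::real_normed_vector set \<Rightarrow> 'a \<Rightarrow> 'a \<Rightarrow> (real \<Rightarrow> 'a) set" where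
  "paths_in S x y = {c. valid_path c \<and> path_image c \<subseteq> S \<and> pathstart c = x \<and> pathfinish c = y}"

definition path_dist :: "('a \<Rightarrow> 'a \<Rightarrow> real) \<Rightarrow> 'a::real_normed_vector set \<Rightarrow> 'a \<Rightarrow> 'a \<Rightarrow> ennreal" where
  "path_dist N S x y = (INF c\<in>paths_in S x y. path_length N c)"

text \<open>Continuity makes the speed measurable. Homogeneity with the absolute value makes length
  invariant under affine reparameterization, including reversal.\<close>

locale length_structure =
  fixes N :: "'a::real_normed_vector \<Rightarrow> 'a \<Rightarrow> real"
  assumes continuous_N: "continuous_on UNIV (\<lambda>(x, v). N x v)"
    and N_scaleR: "N x (r *\<^sub>R v) = \<bar>r\<bar> * N x v"
begin

lemma speed_measurable:
  assumes "valid_path c"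
  shows "(\<lambda>t. ennreal (N (c t) (vector_derivative c (at t))) * indicator {0..1} t) \<in> borel_measurable borel"
proof -
  have "(\<lambda>t. ennreal (indicator {0..1} t *\<^sub>R N (c t) (vector_derivative c (at t)))) \<in> borel_measurable borel"
    using valid_path_speed_measurable[OF assms continuous_N] by simp
  then show ?thesis
    by (rule measurable_cong[THEN iffD1, rotated]) (auto simp: indicator_def)
qed

text \<open>Change of variables, used with slope -1 for reversed paths and slope 2 for either half
  of a joined path. Agreement is required only over the open interval, since a joined path may have
  a corner at 1/2.\<close>

lemma speed_integral_affine:
  assumes g: "valid_path g" and "b \<noteq> 0" and c: "\<And>t. a + b * t \<in> {0<..<1} \<Longrightarrow> c t = g (a + b * t)"
  shows "(\<integral>\<^sup>+t. ennreal (N (c t) (vector_derivative c (at t))) * indicator {0..1} (a + b * t) \<partial>lborel) = path_length N g"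
proof -
  obtain X where X: "finite X" "0 \<in> X" "1 \<in> X"
    "\<And>t. t \<in> {0..1} - X \<Longrightarrow> (g has_vector_derivative vector_derivative g (at t)) (at t)"
    using valid_path_differentiable[OF g] by metis
  define F where "F t = ennreal (N (g t) (vector_derivative g (at t))) * indicator {0..1} t" for t
  have F: "F \<in> borel_measurable borel" unfolding F_def by (rule speed_measurable[OF g])
  have eq: "ennreal (N (c t) (vector_derivative c (at t))) * indicator {0..1} (a + b * t) = ennreal \<bar>b\<bar> * F (a + b * t)"
    if t: "a + b * t \<notin> X" for t
  proof (cases "a + b * t \<in> {0<..<1}")
    case True
    let ?D = "vector_derivative g (at (a + b * t))"
    have "((g \<circ> (\<lambda>t. a + b * t)) has_vector_derivative b *\<^sub>R ?D) (at t)"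
      by (rule vector_diff_chain_at[rotated])
        (use X(4)[of "a + b * t"] True t in \<open>auto intro!: derivative_eq_intros\<close>)
    moreover have "open ((\<lambda>t. a + b * t) -` {0<..<1})" by (intro open_vimage continuous_intros open_greaterThanLessThan)
    ultimately have "(c has_vector_derivative b *\<^sub>R ?D) (at t)"
      by (rule has_vector_derivative_transform_within_open) (use c True in auto)
    then have "vector_derivative c (at t) = b *\<^sub>R ?D" by (rule vector_derivative_at)
    then show ?thesis using True c[OF True] by (simp add: F_def N_scaleR ennreal_mult')
  next
    case False
    then have "a + b * t \<notin> {0..1}" using t X(2,3) by (auto simp: less_eq_real_def)
    then show ?thesis by (simp add: F_def)
  qed
  have "finite ((\<lambda>t. a + b * t) -` X)"
    using X(1) \<open>b \<noteq> 0\<close> by (intro finite_vimageI) (auto simp: inj_on_def)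
  then have "AE t in lborel. ennreal (N (c t) (vector_derivative c (at t))) * indicator {0..1} (a + b * t) = ennreal \<bar>b\<bar> * F (a + b * t)"
    by (rule AE_lborel_finite) (use eq in auto)
  then have "(\<integral>\<^sup>+t. ennreal (N (c t) (vector_derivative c (at t))) * indicator {0..1} (a + b * t) \<partial>lborel)
      = (\<integral>\<^sup>+t. ennreal \<bar>b\<bar> * F (a + b * t) \<partial>lborel)"
    by (rule nn_integral_cong_AE)
  also have "\<dots> = ennreal \<bar>b\<bar> * (\<integral>\<^sup>+t. F (a + b * t) \<partial>lborel)"
    by (intro nn_integral_cmult measurable_compose[OF _ F]) simp
  also have "\<dots> = (\<integral>\<^sup>+t. F t \<partial>lborel)" using nn_integral_real_affine[OF F \<open>b \<noteq> 0\<close>, of a] by simp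
  finally show ?thesis by (simp add: path_length_def F_def)
qed

lemma path_length_reversepath:
  assumes "valid_path g"
  shows "path_length N (reversepath g) = path_length N g"
proof -
  have "path_length N (reversepath g) = (\<integral>\<^sup>+t. ennreal (N (reversepath g t) (vector_derivative (reversepath g) (at t))) * indicator {0..1} (1 + -1 * t) \<partial>lborel)"
    unfolding path_length_def by (intro nn_integral_cong) (auto simp: indicator_def)
  also have "\<dots> = path_length N g"
    by (rule speed_integral_affine[OF assms]) (auto simp: reversepath_def)
  finally show ?thesis .
qed

lemma path_length_join:
  assumes "valid_path g" "valid_path h" "pathfinish g = pathstart h"
  shows "path_length N (g +++ h) = path_length N g + path_length N h"
proof -
  let ?F = "\<lambda>t. ennreal (N ((g +++ h) t) (vector_derivative (g +++ h) (at t)))"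
  have meas: "(\<lambda>t. ?F t * indicator {0..1} t) \<in> borel_measurable borel"
    by (rule speed_measurable[OF valid_path_join[OF assms]])
  have ind: "?F t * indicator {0..1} (0 + 2 * t) = ?F t * indicator {0..1} t * indicator {0..1} (0 + 2 * t)"
    "?F t * indicator {0..1} (-1 + 2 * t) = ?F t * indicator {0..1} t * indicator {0..1} (-1 + 2 * t)" for t
    by (auto simp: indicator_def)
  have meas1: "(\<lambda>t. ?F t * indicator {0..1} (0 + 2 * t)) \<in> borel_measurable borel"
    "(\<lambda>t. ?F t * indicator {0..1} (-1 + 2 * t)) \<in> borel_measurable borel"
    unfolding ind using meas by measurable
  have "path_length N (g +++ h) = (\<integral>\<^sup>+t. ?F t * indicator {0..1} (0 + 2 * t) + ?F t * indicator {0..1} (-1 + 2 * t) \<partial>lborel)"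
    unfolding path_length_def
    \<comment> \<open>At \<open>t = 1/2\<close> both indicators are 1, so the integrands may differ
      at this one point.\<close>
    by (intro nn_integral_cong_AE AE_lborel_finite[of "{1/2}"]) (auto simp: indicator_def)
  also have "\<dots> = (\<integral>\<^sup>+t. ?F t * indicator {0..1} (0 + 2 * t) \<partial>lborel) + (\<integral>\<^sup>+t. ?F t * indicator {0..1} (-1 + 2 * t) \<partial>lborel)"
    using meas1 by (intro nn_integral_add) auto
  also have "(\<integral>\<^sup>+t. ?F t * indicator {0..1} (0 + 2 * t) \<partial>lborel) = path_length N g"
    by (rule speed_integral_affine[OF assms(1)]) (auto simp: joinpaths_def)
  also have "(\<integral>\<^sup>+t. ?F t * indicator {0..1} (-1 + 2 * t) \<partial>lborel) = path_length N h"
    by (rule speed_integral_affine[OF assms(2)]) (auto simp: joinpaths_def algebra_simps)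
  finally show ?thesis .
qed

lemma path_dist_commute: "path_dist N S x y = path_dist N S y x"
proof -
  have "path_dist N S x y \<le> path_dist N S y x" for x y
    unfolding path_dist_def
  proof (rule INF_mono)
    fix c assume c: "c \<in> paths_in S y x"
    then have "reversepath c \<in> paths_in S x y" by (auto simp: paths_in_def)
    then show "\<exists>c'\<in>paths_in S x y. path_length N c' \<le> path_length N c"
      using path_length_reversepath[of c] c by (intro bexI[of _ "reversepath c"]) (auto simp: paths_in_def)
  qed
  then show ?thesis by (simp add: antisym)
qed

lemma path_dist_triangle: "path_dist N S x z \<le> path_dist N S x y + path_dist N S y z"
  unfolding path_dist_def[of N S x y] path_dist_def[of N S y z]
proof (rule le_INF_add_INF)
  fix g h assume gh: "g \<in> paths_in S x y" "h \<in> paths_in S y z"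
  then have "g +++ h \<in> paths_in S x z"
    by (auto simp: paths_in_def valid_path_join path_image_join)
  then have "path_dist N S x z \<le> path_length N (g +++ h)" unfolding path_dist_def by (rule INF_lower)
  then show "path_dist N S x z \<le> path_length N g + path_length N h"
    using gh by (subst (asm) path_length_join) (auto simp: paths_in_def)
qed

end

text \<open>The displacement is the integral of the derivative, and the norm of an integral is at
  most the integral of the norm. Finite length makes the derivative Lebesgue integrable, which
  identifies its integral with the gauge integral of the fundamental theorem; infinite length leaves
  nothing to show.\<close>

lemma norm_le_path_length:
  fixes c :: "real \<Rightarrow> 'a::euclidean_space"
  assumes "valid_path c"
  shows "ennreal (norm (pathfinish c - pathstart c)) \<le> path_length (\<lambda>_. norm) c"
proof (cases "path_length (\<lambda>_. norm) c = \<infinity>")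
  case False
  obtain X where X: "finite X" "0 \<in> X" "1 \<in> X" "continuous_on {0..1} c"
    "\<And>t. t \<in> {0..1} - X \<Longrightarrow> (c has_vector_derivative vector_derivative c (at t)) (at t)"
    using valid_path_differentiable[OF assms(1)] by metis
  let ?f = "\<lambda>t. indicator {0..1} t *\<^sub>R vector_derivative c (at t)"
  have eq: "(\<integral>\<^sup>+t. ennreal (norm (?f t)) \<partial>lborel) = path_length (\<lambda>_. norm) c"
    unfolding path_length_def by (intro nn_integral_cong) (auto simp: indicator_def)
  have "?f \<in> borel_measurable borel"
    using valid_path_speed_measurable[OF assms, of "\<lambda>_ v. v"] by (simp add: case_prod_unfold continuous_intros)
  then have int: "integrable lborel ?f"
    using False eq by (intro integrableI_bounded) (auto simp: top.not_eq_extremum)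
  have "((\<lambda>t. vector_derivative c (at t)) has_integral (c 1 - c 0)) {0..1}"
    by (rule fundamental_theorem_of_calculus_interior_strong[OF X(1)]) (use X in auto)
  then have "integral {0..1} (\<lambda>t. vector_derivative c (at t)) = c 1 - c 0" by (rule integral_unique)
  moreover have "integral\<^sup>L lborel ?f = integral {0..1} (\<lambda>t. vector_derivative c (at t))"
    using set_borel_integral_eq_integral(2)[of "{0..1}" "\<lambda>t. vector_derivative c (at t)"] int
    by (simp add: set_integrable_def set_lebesgue_integral_def)
  ultimately show ?thesis
    using integral_norm_bound_ennreal[OF int] eq by (simp add: pathfinish_def pathstart_def)
qed simp

section \<open>The sphere and its tangent bundle\<close>

lemma sphere_dist_eq: "sphere_dist p q = path_dist (\<lambda>_. norm) (sphere 0 1) p q"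
  by (simp add: sphere_dist_def path_dist_def path_length_def paths_in_def)

lemma sasaki_dist_eq: "sasaki_dist x y = path_dist sasaki_norm tangent_bundle x y"
  by (simp add: sasaki_dist_def path_dist_def path_length_def paths_in_def)

lemma sasaki_norm_eq:
  "sasaki_norm x v = sqrt ((norm (fst v))\<^sup>2 + (norm (snd v - (snd v \<bullet> fst x) *\<^sub>R fst x))\<^sup>2)"
  by (cases x; cases v) simp

interpretation sphere: length_structure "\<lambda>_. norm :: real^3 \<Rightarrow> real"
  by unfold_locales (auto simp: case_prod_unfold intro!: continuous_intros)

interpretation sasaki: length_structure sasaki_norm
proof
  show "continuous_on UNIV (\<lambda>(x, v). sasaki_norm x v)"
    unfolding sasaki_norm_eq case_prod_unfold by (intro continuous_intros)
  fix x v :: "(real^3) \<times> (real^3)" and r :: real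
  have "snd (r *\<^sub>R v) - (snd (r *\<^sub>R v) \<bullet> fst x) *\<^sub>R fst x = r *\<^sub>R (snd v - (snd v \<bullet> fst x) *\<^sub>R fst x)"
    by (simp add: algebra_simps)
  then have "(norm (fst (r *\<^sub>R v)))\<^sup>2 + (norm (snd (r *\<^sub>R v) - (snd (r *\<^sub>R v) \<bullet> fst x) *\<^sub>R fst x))\<^sup>2
     = r\<^sup>2 * ((norm (fst v))\<^sup>2 + (norm (snd v - (snd v \<bullet> fst x) *\<^sub>R fst x))\<^sup>2)"
    by (simp only: norm_scaleR fst_scaleR power_mult_distrib power2_abs distrib_left)
  then show "sasaki_norm x (r *\<^sub>R v) = \<bar>r\<bar> * sasaki_norm x v"
    unfolding sasaki_norm_eq by (simp add: real_sqrt_mult)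
qed

lemma norm_le_sphere_dist: "ennreal (norm (p - q)) \<le> sphere_dist p q"
  unfolding sphere_dist_eq path_dist_def
proof (rule INF_greatest)
  fix c assume "c \<in> paths_in (sphere 0 1) p q"
  then show "ennreal (norm (p - q)) \<le> path_length (\<lambda>_. norm) c"
    using norm_le_path_length[of c] by (auto simp: paths_in_def norm_minus_commute)
qed

text \<open>The base projection shortens paths because the Sasaki norm contains the norm of the base
  component as a summand under the root. Besides the inequality between \<open>d0\<close> and
  \<open>d1\<close>, this transfers finiteness to \<open>d0\<close> and separation of curves to
  \<open>d1\<close>.\<close>

lemma sphere_dist_le_sasaki_dist: "sphere_dist p q \<le> sasaki_dist (p, v) (q, w)"
  unfolding sphere_dist_eq sasaki_dist_eq path_dist_def
proof (rule INF_mono)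
  fix c assume c: "c \<in> paths_in tangent_bundle (p, v) (q, w)"
  then have vc: "valid_path c" by (simp add: paths_in_def)
  obtain X where X: "finite X"
    "\<And>t. t \<in> {0..1} - X \<Longrightarrow> (c has_vector_derivative vector_derivative c (at t)) (at t)"
    using valid_path_differentiable[OF vc] by metis
  have "path_length (\<lambda>_. norm) (fst \<circ> c) \<le> path_length sasaki_norm c"
    unfolding path_length_def
  proof (intro nn_integral_mono_AE AE_lborel_finite[OF X(1)])
    fix t :: real assume "t \<notin> X"
    show "ennreal (norm (vector_derivative (fst \<circ> c) (at t))) * indicator {0..1} t
        \<le> ennreal (sasaki_norm (c t) (vector_derivative c (at t))) * indicator {0..1} t"
    proof (cases "t \<in> {0..1}")
      case True
      have "((\<lambda>t. fst (c t)) has_vector_derivative fst (vector_derivative c (at t))) (at t)"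
        by (rule bounded_linear.has_vector_derivative[OF bounded_linear_fst]) (use X(2) True \<open>t \<notin> X\<close> in auto)
      then have "vector_derivative (fst \<circ> c) (at t) = fst (vector_derivative c (at t))"
        by (simp add: o_def vector_derivative_at)
      then show ?thesis by (auto simp: sasaki_norm_eq intro!: mult_right_mono ennreal_leI real_le_rsqrt)
    qed simp
  qed
  moreover have "fst \<circ> c \<in> paths_in (sphere 0 1) p q"
  proof -
    have "c t \<in> tangent_bundle" if "t \<in> {0..1}" for t
      using c that by (auto simp: paths_in_def path_image_def)
    then have "path_image (fst \<circ> c) \<subseteq> sphere 0 1"
      unfolding path_image_def by (force simp: tangent_bundle_def)
    then show ?thesis
      using c linear_image_valid_path[OF vc linear_fst] by (auto simp: paths_in_def pathstart_def pathfinish_def)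
  qed
  ultimately show "\<exists>c'\<in>paths_in (sphere 0 1) p q. path_length (\<lambda>_. norm) c' \<le> path_length sasaki_norm c"
    by blast
qed

text \<open>\<open>w\<close> is the normalized part of \<open>q\<close> orthogonal to
  \<open>p\<close>. For equal or antipodal points that part vanishes and any unit vector orthogonal
  to \<open>p\<close> serves, whence the condition on the dimension.\<close>

lemma great_circle_direction:
  fixes p q :: "'a::euclidean_space"
  assumes "norm p = 1" "norm q = 1" "2 \<le> DIM('a)"
  obtains w where "norm w = 1" "w \<bullet> p = 0" "q = cos (arccos (p \<bullet> q)) *\<^sub>R p + sin (arccos (p \<bullet> q)) *\<^sub>R w"
proof -
  have "\<bar>p \<bullet> q\<bar> \<le> 1" using Cauchy_Schwarz_ineq2[of p q] assms by simp
  then have r: "-1 \<le> p \<bullet> q" "p \<bullet> q \<le> 1" by auto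
  define s where "s = sin (arccos (p \<bullet> q))"
  have s: "s * s = 1 - (p \<bullet> q) * (p \<bullet> q)"
    using r sin_squared_eq[of "arccos (p \<bullet> q)"] by (simp add: s_def power2_eq_square)
  have pp: "p \<bullet> p = 1" "q \<bullet> q = 1" using assms by (simp_all add: dot_square_norm)
  define z where "z = q - (p \<bullet> q) *\<^sub>R p"
  have z: "z \<bullet> z = s\<^sup>2" "z \<bullet> p = 0"
    unfolding power2_eq_square s by (simp_all add: z_def algebra_simps inner_diff_left inner_diff_right pp inner_commute)
  show thesis
  proof (cases "s = 0")
    case True
    then have "z = 0" using z by simp
    obtain y where y: "y \<noteq> 0" "orthogonal p y" using orthogonal_to_vector_exists[OF assms(3)] by blast
    show ?thesis
      by (rule that[of "y /\<^sub>R norm y"])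
        (use y r \<open>z = 0\<close> True in \<open>auto simp: s_def[symmetric] z_def orthogonal_def inner_commute\<close>)
  next
    case False
    have "norm z = \<bar>s\<bar>" using z by (simp add: norm_eq_sqrt_inner)
    then show ?thesis
      by (intro that[of "z /\<^sub>R s"]) (use False r z in \<open>auto simp: s_def[symmetric] z_def\<close>)
  qed
qed

lemma norm_orthogonal_part_le:
  fixes e z :: "'a::real_inner"
  assumes "norm e = 1"
  shows "norm (z - (z \<bullet> e) *\<^sub>R e) \<le> norm z"
proof -
  have "e \<bullet> e = 1" using assms by (simp add: norm_eq_1)
  then have "(z - (z \<bullet> e) *\<^sub>R e) \<bullet> (z - (z \<bullet> e) *\<^sub>R e) = z \<bullet> z - (z \<bullet> e) * (z \<bullet> e)"
    by (simp add: inner_diff_left inner_diff_right inner_commute algebra_simps)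
  then show ?thesis by (simp add: norm_le)
qed

text \<open>The path follows a great circle in the base; its vector part is the linear interpolation of
  \<open>v\<close> and \<open>w\<close>, projected to the tangent planes.\<close>

lemma sasaki_dist_le:
  assumes "norm p = 1" "v \<bullet> p = 0" "norm q = 1" "w \<bullet> q = 0"
  shows "sasaki_dist (p, v) (q, w) \<le> ennreal (arccos (p \<bullet> q) * (1 + norm v + norm w) + norm (v - w))"
proof -
  define \<theta> where "\<theta> = arccos (p \<bullet> q)"
  have "\<bar>p \<bullet> q\<bar> \<le> 1" using Cauchy_Schwarz_ineq2[of p q] assms by simp
  then have \<theta>: "0 \<le> \<theta>" unfolding \<theta>_def by (intro arccos_lbound) auto
  obtain n where n: "norm n = 1" "n \<bullet> p = 0" "q = cos \<theta> *\<^sub>R p + sin \<theta> *\<^sub>R n"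
    using great_circle_direction[OF assms(1,3)] unfolding \<theta>_def by auto
  define c where "c t = cos (t * \<theta>) *\<^sub>R p + sin (t * \<theta>) *\<^sub>R n" for t
  define c' where "c' t = \<theta> *\<^sub>R (- sin (t * \<theta>) *\<^sub>R p + cos (t * \<theta>) *\<^sub>R n)" for t
  define l where "l t = (1 - t) *\<^sub>R v + t *\<^sub>R w" for t
  define u where "u t = l t - (l t \<bullet> c t) *\<^sub>R c t" for t
  define u' where "u' t = (w - v) - (((w - v) \<bullet> c t + l t \<bullet> c' t) *\<^sub>R c t + (l t \<bullet> c t) *\<^sub>R c' t)" for t
  have pn: "p \<bullet> p = 1" "n \<bullet> n = 1" "p \<bullet> n = 0" "n \<bullet> p = 0"
    using assms n by (simp_all add: dot_square_norm inner_commute)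
  have sc: "sin x * sin x + cos x * cos x = 1" for x :: real
    using sin_cos_squared_add[of x] by (simp add: power2_eq_square)
  have cc: "c t \<bullet> c t = 1" "c' t \<bullet> c t = 0" "c t \<bullet> c' t = 0" for t
    using sc[of "t * \<theta>"]
    by (simp_all add: c_def c'_def inner_add_left inner_add_right pn algebra_simps)
  have "c' t \<bullet> c' t = \<theta> * \<theta> * (sin (t * \<theta>) * sin (t * \<theta>) + cos (t * \<theta>) * cos (t * \<theta>))" for t
    unfolding c'_def inner_scaleR_left inner_scaleR_right inner_add_left inner_add_right pn by algebra
  then have cc': "c' t \<bullet> c' t = \<theta>\<^sup>2" for t unfolding power2_eq_square by (simp only: sc mult_1_right)
  have norm_c: "norm (c t) = 1" "norm (c' t) = \<theta>" for t
    using cc cc' \<theta> by (simp_all add: norm_eq_sqrt_inner)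
  have dc: "(c has_vector_derivative c' t) (at t)" for t
    unfolding c_def[abs_def] c'_def by (auto intro!: derivative_eq_intros simp: algebra_simps)
  have dl: "(l has_vector_derivative (w - v)) (at t)" for t
    unfolding l_def[abs_def] by (auto intro!: derivative_eq_intros simp: algebra_simps)
  have du: "(u has_vector_derivative u' t) (at t)" for t
  proof -
    have "((\<lambda>t. l t \<bullet> c t) has_real_derivative (l t \<bullet> c' t + (w - v) \<bullet> c t)) (at t)"
      using bounded_bilinear.has_vector_derivative[OF bounded_bilinear_inner dl dc]
      by (simp add: has_real_derivative_iff_has_vector_derivative)
    from has_vector_derivative_diff[OF dl has_vector_derivative_scaleR[OF this dc]]
    show ?thesis unfolding u_def[abs_def] u'_def by (simp add: add.commute)
  qed
  have dC: "((\<lambda>t. (c t, u t)) has_vector_derivative (c' t, u' t)) (at t)" for t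
    using dc du by (rule has_vector_derivative_Pair)
  have contC: "continuous_on A (\<lambda>t. (c' t, u' t))" for A
    unfolding u'_def c'_def c_def l_def by (intro continuous_intros)
  have cont: "continuous_on A (\<lambda>t. (c t, u t))" for A
    unfolding u_def c_def l_def by (intro continuous_intros)
  have valid: "valid_path (\<lambda>t. (c t, u t))"
    unfolding valid_path_def piecewise_C1_differentiable_on_def C1_differentiable_on_def
    using cont contC dC by (intro conjI exI[of _ "{}"] exI[of _ "\<lambda>t. (c' t, u' t)"]) auto
  have "(\<lambda>t. (c t, u t)) \<in> paths_in tangent_bundle (p, v) (q, w)"
  proof -
    have "c 0 = p" "c 1 = q" "l 0 = v" "l 1 = w" using n by (simp_all add: c_def l_def)
    then have "u 0 = v" "u 1 = w" using assms by (simp_all add: u_def)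
    moreover have "(c t, u t) \<in> tangent_bundle" for t
      using norm_c by (simp add: tangent_bundle_def u_def inner_diff_left cc)
    ultimately show ?thesis
      using valid \<open>c 0 = p\<close> \<open>c 1 = q\<close>
      by (auto simp: paths_in_def pathstart_def pathfinish_def path_image_def)
  qed
  then have "sasaki_dist (p, v) (q, w) \<le> path_length sasaki_norm (\<lambda>t. (c t, u t))"
    unfolding sasaki_dist_eq path_dist_def by (rule INF_lower)
  also have "\<dots> \<le> (\<integral>\<^sup>+t. ennreal (\<theta> * (1 + norm v + norm w) + norm (v - w)) * indicator {0..1::real} t \<partial>lborel)"
    unfolding path_length_def
  proof (rule nn_integral_mono)
    fix t :: real
    show "ennreal (sasaki_norm (c t, u t) (vector_derivative (\<lambda>t. (c t, u t)) (at t))) * indicator {0..1} t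
      \<le> ennreal (\<theta> * (1 + norm v + norm w) + norm (v - w)) * indicator {0..1} t"
    proof (cases "t \<in> {0..1}")
      case True
      \<comment> \<open>Projecting to the tangent plane at \<open>c t\<close> removes the multiple
        of \<open>c t\<close> in \<open>u' t\<close>. What remains is the projection of
        \<open>w - v\<close> and a term of size at most \<open>(norm v + norm w) * \<theta>\<close>,
        caused by the turning of the tangent plane.\<close>
      have proj: "u' t - (u' t \<bullet> c t) *\<^sub>R c t = ((w - v) - ((w - v) \<bullet> c t) *\<^sub>R c t) - (l t \<bullet> c t) *\<^sub>R c' t"
        by (simp add: u'_def inner_diff_left inner_add_left cc algebra_simps)
      have 1: "norm ((w - v) - ((w - v) \<bullet> c t) *\<^sub>R c t) \<le> norm (v - w)"
        unfolding norm_minus_commute[of v w] by (rule norm_orthogonal_part_le[OF norm_c(1)])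
      have "norm (l t) \<le> (1 - t) * norm v + t * norm w"
        unfolding l_def using norm_triangle_ineq[of "(1-t) *\<^sub>R v" "t *\<^sub>R w"] True by simp
      also have "\<dots> \<le> 1 * norm v + 1 * norm w" using True by (intro add_mono mult_right_mono) auto
      finally have "\<bar>l t \<bullet> c t\<bar> \<le> norm v + norm w"
        using Cauchy_Schwarz_ineq2[of "l t" "c t"] norm_c by (simp add: order_trans)
      then have 2: "norm ((l t \<bullet> c t) *\<^sub>R c' t) \<le> (norm v + norm w) * \<theta>"
        using \<theta> by (simp add: norm_c mult_right_mono)
      have "sasaki_norm (c t, u t) (c' t, u' t) \<le> norm (c' t) + norm (u' t - (u' t \<bullet> c t) *\<^sub>R c t)"
        unfolding sasaki_norm.simps by (rule sqrt_sum_squares_le_sum) auto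
      also have "\<dots> \<le> \<theta> + (norm (v - w) + (norm v + norm w) * \<theta>)"
        unfolding proj norm_c using 1 2 norm_triangle_ineq4[of "(w - v) - ((w - v) \<bullet> c t) *\<^sub>R c t" "(l t \<bullet> c t) *\<^sub>R c' t"]
        by linarith
      finally show ?thesis
        unfolding vector_derivative_at[OF dC]
        by (intro mult_right_mono ennreal_leI) (simp_all add: algebra_simps)
    qed simp
  qed
  also have "\<dots> = ennreal (\<theta> * (1 + norm v + norm w) + norm (v - w))"
    by (simp add: nn_integral_cmult_indicator)
  finally show ?thesis by (simp add: \<theta>_def)
qed

text \<open>Continuity of \<open>arccos\<close> at 1, combined with
  \<open>1 - p \<bullet> q = (p - q) \<bullet> p\<close>, which is at most the chord. It turns
  Euclidean closeness into a small angle for \<open>sasaki_dist_le\<close>.\<close>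

lemma arccos_inner_small:
  assumes "0 < e"
  obtains d where "0 < d"
    "\<And>p q :: 'a::real_inner. norm p = 1 \<Longrightarrow> norm q = 1 \<Longrightarrow> norm (p - q) < d \<Longrightarrow> arccos (p \<bullet> q) < e"
proof -
  obtain r where r: "0 < r" "\<And>x. x \<in> {-1..1} \<Longrightarrow> dist x 1 < r \<Longrightarrow> dist (arccos x) (arccos 1) < e"
    using bspec[OF continuous_on_arccos'[unfolded continuous_on_iff], of 1] \<open>0 < e\<close> by auto
  show thesis
  proof (rule that[of r])
    fix p q :: 'a assume pq: "norm p = 1" "norm q = 1" "norm (p - q) < r"
    have "p \<bullet> p = 1" using pq by (simp add: norm_eq_1)
    then have "1 - p \<bullet> q = (p - q) \<bullet> p" by (simp add: inner_diff_left inner_diff_right inner_commute)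
    also have "\<bar>(p - q) \<bullet> p\<bar> \<le> norm (p - q)" using Cauchy_Schwarz_ineq2[of "p - q" p] pq by simp
    finally have "\<bar>1 - p \<bullet> q\<bar> < r" using pq by simp
    moreover have "\<bar>p \<bullet> q\<bar> \<le> 1" using Cauchy_Schwarz_ineq2[of p q] pq by simp
    then have "p \<bullet> q \<in> {-1..1}" unfolding atLeastAtMost_iff abs_le_iff by linarith
    ultimately show "arccos (p \<bullet> q) < e" using r(2)[of "p \<bullet> q"] by (simp add: dist_real_def)
  qed (rule r(1))
qed

section \<open>Curves of bounded curvature\<close>

text \<open>The triple product is the determinant of \<open>a\<close>, \<open>x\<close>,
  \<open>y\<close>, so its square is their Gram determinant. It yields the normal component of the
  acceleration from inner products alone.\<close>

lemma Gram_cross3: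
  "(a \<bullet> cross3 x y)\<^sup>2 = (a \<bullet> a) * (x \<bullet> x) * (y \<bullet> y) + 2 * (a \<bullet> x) * (x \<bullet> y) * (a \<bullet> y)
     - (a \<bullet> a) * (x \<bullet> y)\<^sup>2 - (x \<bullet> x) * (a \<bullet> y)\<^sup>2 - (y \<bullet> y) * (a \<bullet> x)\<^sup>2"
  by (simp add: cross3_def inner_vec_def sum_3 power2_eq_square algebra_simps)

lemma constant_inner_derivative:
  fixes f g :: "real \<Rightarrow> 'a::real_inner"
  assumes "(f has_vector_derivative f') (at t within {0..1})" "(g has_vector_derivative g') (at t within {0..1})"
    and "t \<in> {0..1}" and const: "\<And>s. s \<in> {0..1} \<Longrightarrow> f s \<bullet> g s = c"
  shows "f t \<bullet> g' + f' \<bullet> g t = 0"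
proof -
  have 1: "((\<lambda>s. f s \<bullet> g s) has_vector_derivative f t \<bullet> g' + f' \<bullet> g t) (at t within {0..1})"
    by (rule bounded_bilinear.has_vector_derivative[OF bounded_bilinear_inner assms(1,2)])
  have 2: "((\<lambda>s. f s \<bullet> g s) has_vector_derivative 0) (at t within {0..1})"
    by (rule has_vector_derivative_transform[OF assms(3) _ has_vector_derivative_const[of c]]) (simp add: const)
  show ?thesis
    using vector_derivative_unique_within_closed_interval[of 0 1 t, unfolded box_real, OF _ _ 1 2] assms(3) by simp
qed

lemma curve_velocity:
  assumes "C1_regular_curve \<gamma>" "t \<in> {0..1}"
  shows "(\<gamma> has_vector_derivative velocity \<gamma> t) (at t within {0..1})" "norm (\<gamma> t) = 1"
    "norm (velocity \<gamma> t) = curve_length \<gamma>" "0 < curve_length \<gamma>" "velocity \<gamma> t \<bullet> \<gamma> t = 0"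
proof -
  have d: "(\<gamma> has_vector_derivative velocity \<gamma> t) (at t within {0..1})" if "t \<in> {0..1}" for t
    using assms(1) that unfolding C1_regular_curve_def velocity_def differentiable_on_def
    by (simp add: vector_derivative_works[symmetric])
  have sph: "norm (\<gamma> t) = 1" if "t \<in> {0..1}" for t
    using assms(1) that unfolding C1_regular_curve_def by (auto simp: image_subset_iff)
  show "(\<gamma> has_vector_derivative velocity \<gamma> t) (at t within {0..1})" "norm (\<gamma> t) = 1"
    using d sph assms(2) by auto
  show 1: "norm (velocity \<gamma> t) = curve_length \<gamma>"
    using assms unfolding C1_regular_curve_def by blast
  have "velocity \<gamma> t \<noteq> 0" using assms unfolding C1_regular_curve_def by blast
  then show "0 < curve_length \<gamma>" using 1 by (metis zero_less_norm_iff)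
  have "\<gamma> t \<bullet> velocity \<gamma> t + velocity \<gamma> t \<bullet> \<gamma> t = 0"
    by (rule constant_inner_derivative[OF d d, where c = 1]) (use assms sph in \<open>auto simp: dot_square_norm\<close>)
  then show "velocity \<gamma> t \<bullet> \<gamma> t = 0" by (simp add: inner_commute)
qed

text \<open>Components of \<open>a\<close> in the Frenet frame, with \<open>L\<close> the length:
  constant speed kills the tangential one, differentiating the orthogonality of velocity and
  position gives \<open>- L\<^sup>2\<close> along the position, and the normal one is
  \<open>L\<^sup>2\<close> times the geodesic curvature.\<close>

lemma acceleration_norm:
  assumes \<gamma>: "C1_regular_curve \<gamma>" and t: "t \<in> {0..1}"
    and a: "(velocity \<gamma> has_vector_derivative a) (at t within {0..1})"
  shows "(norm a)\<^sup>2 = (curve_length \<gamma>)^4 * (1 + (geodesic_curvature \<gamma> t)\<^sup>2)"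
proof -
  let ?L = "curve_length \<gamma>" and ?v = "velocity \<gamma>"
  note c = curve_velocity[OF \<gamma>]
  have L: "0 < ?L" using c(4)[OF t] .
  have v2: "?v s \<bullet> ?v s = ?L\<^sup>2" if "s \<in> {0..1}" for s using c(3)[OF that] by (simp add: dot_square_norm)
  have g2: "\<gamma> t \<bullet> \<gamma> t = 1" using c(2)[OF t] by (simp add: dot_square_norm)
  have "?v t \<bullet> a + a \<bullet> ?v t = 0" by (rule constant_inner_derivative[OF a a t v2])
  then have av: "a \<bullet> ?v t = 0" by (simp add: inner_commute)
  have "?v t \<bullet> ?v t + a \<bullet> \<gamma> t = 0"
    by (rule constant_inner_derivative[OF a c(1)[OF t] t c(5)])
  then have ag: "a \<bullet> \<gamma> t = - ?L\<^sup>2" using v2[OF t] by simp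
  have ut: "unit_tangent \<gamma> s = ?v s /\<^sub>R ?L" if "s \<in> {0..1}" for s
    using c(3)[OF that] by (simp add: unit_tangent_def)
  \<comment> \<open>One factor \<open>1 / L\<close> normalizes the velocity, the other comes from
    the chain rule for the passage to arc length.\<close>
  have deriv: "((\<lambda>u. unit_tangent \<gamma> (u / ?L)) has_vector_derivative a /\<^sub>R ?L\<^sup>2) (at (?L * t) within {0..?L})"
  proof -
    have 1: "((\<lambda>u. u / ?L) has_vector_derivative 1 / ?L) (at (?L * t) within {0..?L})"
      using L by (auto intro!: derivative_eq_intros)
    have "(\<lambda>u. u / ?L) ` {0..?L} \<subseteq> {0..1}" using L by auto
    then have 2: "(?v has_vector_derivative a) (at (?L * t / ?L) within (\<lambda>u. u / ?L) ` {0..?L})"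
      using a L by (auto intro: has_vector_derivative_within_subset)
    have "((\<lambda>u. (1 / ?L) *\<^sub>R (?v \<circ> (\<lambda>u. u / ?L)) u) has_vector_derivative (1 / ?L) *\<^sub>R ((1 / ?L) *\<^sub>R a)) (at (?L * t) within {0..?L})"
      using vector_diff_chain_within[OF 1 2]
      by (intro bounded_linear.has_vector_derivative[OF bounded_linear_scaleR_right])
    then have "((\<lambda>u. (1 / ?L) *\<^sub>R (?v \<circ> (\<lambda>u. u / ?L)) u) has_vector_derivative a /\<^sub>R ?L\<^sup>2) (at (?L * t) within {0..?L})"
      by (simp add: power2_eq_square inverse_eq_divide)
    then show ?thesis
      by (rule has_vector_derivative_transform[rotated 2]) (use t L in \<open>auto simp: ut inverse_eq_divide\<close>)
  qed
  have "vector_derivative (\<lambda>u. unit_tangent \<gamma> (u / ?L)) (at (?L * t) within {0..?L}) = a /\<^sub>R ?L\<^sup>2"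
    using vector_derivative_within_cbox[of 0 ?L "?L * t"] deriv t L by (simp add: mult_le_cancel_left1)
  then have "geodesic_curvature \<gamma> t = (a /\<^sub>R ?L\<^sup>2) \<bullet> unit_normal \<gamma> t"
    using L by (simp add: geodesic_curvature_def curvature_arclength_def)
  then have an: "a \<bullet> unit_normal \<gamma> t = ?L\<^sup>2 * geodesic_curvature \<gamma> t" using L by simp
  have "(a \<bullet> unit_normal \<gamma> t)\<^sup>2 = a \<bullet> a - (?L\<^sup>2)\<^sup>2"
  proof -
    define y where "y = ?v t /\<^sub>R ?L"
    have "y \<bullet> y = 1" using L by (simp add: y_def v2[OF t] power2_eq_square field_simps)
    moreover have "a \<bullet> y = 0" "\<gamma> t \<bullet> y = 0" using av c(5)[OF t] by (simp_all add: y_def inner_commute)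
    ultimately show ?thesis
      unfolding unit_normal_def ut[OF t] Gram_cross3 g2 ag y_def[symmetric] by simp
  qed
  then have "a \<bullet> a = (?L\<^sup>2)\<^sup>2 * (1 + (geodesic_curvature \<gamma> t)\<^sup>2)"
    unfolding an by (simp add: algebra_simps power_mult_distrib)
  then show ?thesis by (simp add: dot_square_norm)
qed

lemma AE_lebesgue_on_negligible:
  assumes "AE x in lebesgue_on S. P x" "S \<in> sets lebesgue"
  shows "negligible {x \<in> S. \<not> P x}"
proof -
  have "AE x in lebesgue. x \<in> S \<longrightarrow> P x" using assms by (subst (asm) AE_restrict_space_iff) auto
  then obtain Z where "Z \<in> null_sets lebesgue" "{x. \<not> (x \<in> S \<longrightarrow> P x)} \<subseteq> Z"
    by (auto simp: eventually_ae_filter)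
  then have "negligible Z" "{x \<in> S. \<not> P x} \<subseteq> Z" by (auto simp: negligible_iff_null_sets)
  then show ?thesis by (rule negligible_subset)
qed

text \<open>The constant depends only on the length and the curvature bounds. The unspecified
  Lipschitz constant \<open>C\<close> of the particular curve yields differentiability almost
  everywhere and justifies integrating the resulting bound on the acceleration.\<close>

lemma velocity_Lipschitz:
  assumes \<gamma>: "\<gamma> \<in> curvature_bounded_curves \<kappa>\<^sub>1 \<kappa>\<^sub>2 P Q"
  shows "((curve_length \<gamma>)\<^sup>2 * (1 + max \<bar>\<kappa>\<^sub>1\<bar> \<bar>\<kappa>\<^sub>2\<bar>))-lipschitz_on {0..1} (velocity \<gamma>)"
proof -
  let ?M = "lebesgue_on {0..1::real}" and ?\<kappa> = "geodesic_curvature \<gamma>" and ?K = "max \<bar>\<kappa>\<^sub>1\<bar> \<bar>\<kappa>\<^sub>2\<bar>"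
  let ?B = "(curve_length \<gamma>)\<^sup>2 * (1 + ?K)"
  obtain C where C: "C-lipschitz_on {0..1} (velocity \<gamma>)" and reg: "C1_regular_curve \<gamma>"
    and lo: "ereal \<kappa>\<^sub>1 < essinf ?M (\<lambda>t. ereal (?\<kappa> t))" and up: "esssup ?M (\<lambda>t. ereal (?\<kappa> t)) < ereal \<kappa>\<^sub>2"
    using \<gamma> by (auto simp: curvature_bounded_curves_def curves_between_def)
  have "AE t in ?M. ereal (?\<kappa> t) \<le> esssup ?M (\<lambda>t. ereal (?\<kappa> t))" by (rule esssup_AE)
  moreover have "AE t in ?M. - ereal (?\<kappa> t) \<le> esssup ?M (\<lambda>t. - ereal (?\<kappa> t))" by (rule esssup_AE)
  ultimately have "AE t in ?M. \<bar>?\<kappa> t\<bar> \<le> ?K"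
  proof eventually_elim
    case (elim t)
    have "?\<kappa> t < \<kappa>\<^sub>2" using le_less_trans[OF elim(1) up] by simp
    moreover have "esssup ?M (\<lambda>t. - ereal (?\<kappa> t)) < - ereal \<kappa>\<^sub>1"
      using lo unfolding essinf_def by (subst (asm) ereal_less_uminus_reorder)
    then have "- ereal (?\<kappa> t) < - ereal \<kappa>\<^sub>1" by (rule le_less_trans[OF elim(2)])
    then have "\<kappa>\<^sub>1 < ?\<kappa> t" by simp
    ultimately show ?case by auto
  qed
  then have neg: "negligible {t \<in> {0..1}. \<not> \<bar>?\<kappa> t\<bar> \<le> ?K}"
    by (rule AE_lebesgue_on_negligible) auto
  define Z where "Z = {t \<in> {0..1}. \<not> velocity \<gamma> differentiable (at t within {0..1})} \<union> {t \<in> {0..1}. \<not> \<bar>?\<kappa> t\<bar> \<le> ?K}"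
  have Z: "negligible Z" unfolding Z_def by (intro negligible_Un neg Lipschitz_differentiable_ae[OF C])
  let ?a = "\<lambda>t. vector_derivative (velocity \<gamma>) (at t within {0..1})"
  have da: "(velocity \<gamma> has_vector_derivative ?a t) (at t within {0..1})" if "t \<in> {0..1} - Z" for t
    using that by (auto simp: Z_def vector_derivative_works[symmetric])
  have a: "norm (?a t) \<le> ?B" if "t \<in> {0..1} - Z" for t
  proof (rule power2_le_imp_le)
    have "(?\<kappa> t)\<^sup>2 \<le> ?K\<^sup>2" using that by (auto simp: Z_def abs_le_square_iff[symmetric])
    \<comment> \<open>The factor \<open>1 + ?K\<close> replaces the square root of
      \<open>1 + ?K\<^sup>2\<close> to keep the constants simple.\<close>
    also have "1 + ?K\<^sup>2 \<le> (1 + ?K)\<^sup>2" by (simp add: power2_sum)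
    finally have "1 + (?\<kappa> t)\<^sup>2 \<le> (1 + ?K)\<^sup>2" by simp
    then have "(curve_length \<gamma>)^4 * (1 + (?\<kappa> t)\<^sup>2) \<le> (curve_length \<gamma>)^4 * (1 + ?K)\<^sup>2"
      by (intro mult_left_mono) auto
    then show "(norm (?a t))\<^sup>2 \<le> ?B\<^sup>2"
      using acceleration_norm[OF reg _ da[OF that]] that by (simp add: power_mult_distrib flip: power_mult)
  qed auto
  have ordered: "norm (velocity \<gamma> y - velocity \<gamma> x) \<le> ?B * (y - x)" if "0 \<le> x" "x \<le> y" "y \<le> 1" for x y
  proof (rule Lipschitz_ae_derivative_bound[OF _ Z])
    show "C-lipschitz_on {x..y} (velocity \<gamma>)" by (rule lipschitz_on_subset[OF C]) (use that in auto)
    show "(velocity \<gamma> has_vector_derivative ?a t) (at t within {x..y})" if "t \<in> {x..y} - Z" for t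
      by (rule has_vector_derivative_within_subset[OF da]) (use that \<open>0 \<le> x\<close> \<open>y \<le> 1\<close> in auto)
    show "norm (?a t) \<le> ?B" if "t \<in> {x..y} - Z" for t
      by (rule a) (use that \<open>0 \<le> x\<close> \<open>y \<le> 1\<close> in auto)
  qed (use that in auto)
  show ?thesis
  proof (rule lipschitz_onI)
    fix x y :: real assume "x \<in> {0..1}" "y \<in> {0..1}"
    then show "dist (velocity \<gamma> x) (velocity \<gamma> y) \<le> ?B * dist x y"
      using ordered[of x y] ordered[of y x] by (cases "x \<le> y") (auto simp: dist_norm norm_minus_commute)
  qed auto
qed

section \<open>Taylor estimates, local length bounds and closeness of velocities\<close>

text \<open>On the segment between \<open>t\<close> and \<open>s\<close> the derivative differs from
  \<open>f' t\<close> by at most \<open>L\<close> times the distance of \<open>s\<close> and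
  \<open>t\<close>. The plain mean value inequality then gives the constant \<open>L\<close> in
  place of the sharp \<open>L/2\<close>. The segment form allows \<open>s\<close> on either side of
  \<open>t\<close>.\<close>

lemma Lipschitz_derivative_Taylor:
  fixes f :: "real \<Rightarrow> 'a::real_normed_vector"
  assumes "\<And>t. t \<in> {a..b} \<Longrightarrow> (f has_vector_derivative f' t) (at t within {a..b})"
    and L: "L-lipschitz_on {a..b} f'" and st: "s \<in> {a..b}" "t \<in> {a..b}"
  shows "norm (f s - f t - (s - t) *\<^sub>R f' t) \<le> L * (s - t)\<^sup>2"
proof -
  have sub: "closed_segment t s \<subseteq> {a..b}" using st by (intro closed_segment_subset) auto
  have "norm (f s - f t - (s - t) *\<^sub>R f' t) \<le> norm (s - t) * (L * norm (s - t))"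
  proof (rule vector_differentiable_bound_linearization[where S = "closed_segment t s"])
    show "(f has_vector_derivative f' x) (at x within closed_segment t s)" if "x \<in> closed_segment t s" for x
      by (rule has_vector_derivative_within_subset[OF assms(1) sub]) (use that sub in auto)
    show "norm (f' x - f' t) \<le> L * norm (s - t)" if x: "x \<in> closed_segment t s" for x
    proof -
      have "norm (f' x - f' t) \<le> L * norm (x - t)"
        using lipschitz_onD[OF L, of x t] x sub st by (auto simp: dist_norm)
      also have "\<dots> \<le> L * norm (s - t)"
        using segment_bound(1)[OF x] lipschitz_on_nonneg[OF L] by (intro mult_left_mono) (auto simp: norm_minus_commute)
      finally show ?thesis .
    qed
  qed auto
  then show ?thesis by (simp add: power2_eq_square algebra_simps flip: abs_mult) 
qed

lemma curve_Taylor: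
  assumes \<gamma>: "\<gamma> \<in> curvature_bounded_curves \<kappa>\<^sub>1 \<kappa>\<^sub>2 P Q" and st: "s \<in> {0..1}" "t \<in> {0..1}"
  shows "norm (\<gamma> s - \<gamma> t - (s - t) *\<^sub>R velocity \<gamma> t)
    \<le> (curve_length \<gamma>)\<^sup>2 * (1 + max \<bar>\<kappa>\<^sub>1\<bar> \<bar>\<kappa>\<^sub>2\<bar>) * (s - t)\<^sup>2"
proof -
  have "C1_regular_curve \<gamma>" using \<gamma> by (simp add: curvature_bounded_curves_def curves_between_def)
  from Lipschitz_derivative_Taylor[OF curve_velocity(1)[OF this] velocity_Lipschitz[OF \<gamma>] st]
  show ?thesis .
qed

text \<open>With \<open>|\<beta>''| \<le> L\<^sup>2 C\<close>, a curve of length \<open>L\<close> is displaced by at least \<open>1/(4 C)\<close> after time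
  \<open>1/(2 L C)\<close>. If \<open>L\<close> is large, this time is too short for \<open>\<alpha>\<close> to move that far.\<close>

lemma curve_length_locally_bounded:
  assumes \<alpha>: "\<alpha> \<in> curvature_bounded_curves \<kappa>\<^sub>1 \<kappa>\<^sub>2 P Q"
  obtains B \<delta> where "0 < \<delta>"
    "\<And>\<beta>. \<beta> \<in> curvature_bounded_curves \<kappa>\<^sub>1 \<kappa>\<^sub>2 P Q \<Longrightarrow> (\<And>t. t \<in> {0..1} \<Longrightarrow> norm (\<alpha> t - \<beta> t) \<le> \<delta>) \<Longrightarrow> curve_length \<beta> \<le> B"
proof -
  define C where "C = 1 + max \<bar>\<kappa>\<^sub>1\<bar> \<bar>\<kappa>\<^sub>2\<bar>"
  define L where "L = curve_length \<alpha>"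
  have C: "1 \<le> C" by (simp add: C_def)
  have L: "0 < L" and nv\<alpha>: "norm (velocity \<alpha> 0) = L"
    using \<alpha> curve_velocity(3,4)[of \<alpha> 0] by (auto simp: curvature_bounded_curves_def curves_between_def L_def)
  \<comment> \<open>The bound 1 keeps times below \<open>h\<close> in the unit interval; the other
    bound limits the travel of \<alpha> within time \<open>h\<close> to about
    \<open>1 / (32 * C)\<close>.\<close>
  define h where "h = min 1 (1 / (32 * C * L))"
  have h: "0 < h" "h \<le> 1" "L * h * C \<le> 1/32" using C L by (auto simp: h_def min_def field_simps)
  \<comment> \<open>For a curve of length exactly \<open>B\<close>, the time \<tau> below would
    equal \<open>h\<close>; longer curves have a smaller \<tau>.\<close>
  define B where "B = 1 / (2 * C * h)"
  show thesis
  proof (rule that[of "1 / (16 * C)" B])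
    show "0 < 1 / (16 * C)" using C by simp
    fix \<beta> assume \<beta>: "\<beta> \<in> curvature_bounded_curves \<kappa>\<^sub>1 \<kappa>\<^sub>2 P Q"
      and close: "\<And>t. t \<in> {0..1} \<Longrightarrow> norm (\<alpha> t - \<beta> t) \<le> 1 / (16 * C)"
    define M where "M = curve_length \<beta>"
    have M: "0 < M" and nv\<beta>: "norm (velocity \<beta> 0) = M"
      using \<beta> curve_velocity(3,4)[of \<beta> 0] by (auto simp: curvature_bounded_curves_def curves_between_def M_def)
    show "curve_length \<beta> \<le> B"
    proof (rule ccontr)
      assume "\<not> curve_length \<beta> \<le> B"
      then have "B < M" by (simp add: M_def)
      \<comment> \<open>This time maximizes
        \<open>M * \<tau> - M\<^sup>2 * C * \<tau>\<^sup>2\<close>, the lower bound for the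
        displacement of \<beta>.\<close>
      define \<tau> where "\<tau> = 1 / (2 * M * C)"
      have \<tau>: "0 < \<tau>" "M * \<tau> = 1 / (2 * C)" "M * C * \<tau> = 1/2" using M C by (auto simp: \<tau>_def)
      have "1 < M * (2 * C * h)" using \<open>B < M\<close> C h by (simp add: B_def divide_less_eq)
      then have "\<tau> < h" using M C by (simp add: \<tau>_def divide_less_eq mult_ac)
      then have t01: "\<tau> \<in> {0..1}" "(0::real) \<in> {0..1}" using \<tau> h by auto
      have "norm (\<beta> \<tau> - \<beta> 0 - \<tau> *\<^sub>R velocity \<beta> 0) \<le> M\<^sup>2 * C * \<tau>\<^sup>2"
        using curve_Taylor[OF \<beta> t01] by (simp add: M_def C_def)
      also have "M\<^sup>2 * C * \<tau>\<^sup>2 = (M * C * \<tau>) * (M * \<tau>)" by (simp add: power2_eq_square)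
      also have "\<dots> = 1 / (4 * C)" unfolding \<tau> by simp
      finally have 1: "norm (\<beta> \<tau> - \<beta> 0 - \<tau> *\<^sub>R velocity \<beta> 0) \<le> 1 / (4 * C)" .
      have 2: "norm (\<tau> *\<^sub>R velocity \<beta> 0) = 1 / (2 * C)" using nv\<beta> \<tau> by (simp add: mult.commute)
      have "norm (\<alpha> \<tau> - \<alpha> 0 - \<tau> *\<^sub>R velocity \<alpha> 0) \<le> L\<^sup>2 * C * \<tau>\<^sup>2"
        using curve_Taylor[OF \<alpha> t01] by (simp add: L_def C_def)
      also have "L\<^sup>2 * C * \<tau>\<^sup>2 = (L * \<tau> * C) * (L * \<tau>)" by (simp add: power2_eq_square)
      also have "\<dots> \<le> (L * h * C) * (L * h)"
        using \<open>\<tau> < h\<close> \<tau> L C by (intro mult_mono mult_left_mono mult_right_mono) auto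
      also have "\<dots> \<le> (1/32) * (L * h)" using h L by (intro mult_right_mono) auto
      also have "\<dots> \<le> L * h" using h L by simp
      finally have 3: "norm (\<alpha> \<tau> - \<alpha> 0 - \<tau> *\<^sub>R velocity \<alpha> 0) \<le> L * h" .
      have "norm (\<tau> *\<^sub>R velocity \<alpha> 0) = \<tau> * L" using nv\<alpha> \<tau> by simp
      also have "\<dots> \<le> L * h" using \<open>\<tau> < h\<close> L by (simp add: mult.commute)
      finally have 4: "norm (\<tau> *\<^sub>R velocity \<alpha> 0) \<le> L * h" .
      have 5: "norm (\<alpha> \<tau> - \<beta> \<tau>) \<le> 1 / (16 * C)" "norm (\<alpha> 0 - \<beta> 0) \<le> 1 / (16 * C)" using close t01 by auto
      have "\<tau> *\<^sub>R velocity \<beta> 0 = (\<alpha> \<tau> - \<alpha> 0 - \<tau> *\<^sub>R velocity \<alpha> 0) + \<tau> *\<^sub>R velocity \<alpha> 0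
          - (\<beta> \<tau> - \<beta> 0 - \<tau> *\<^sub>R velocity \<beta> 0) - (\<alpha> \<tau> - \<beta> \<tau>) + (\<alpha> 0 - \<beta> 0)"
        by (simp add: algebra_simps)
      also have "norm \<dots> \<le> norm (\<alpha> \<tau> - \<alpha> 0 - \<tau> *\<^sub>R velocity \<alpha> 0) + norm (\<tau> *\<^sub>R velocity \<alpha> 0)
          + norm (\<beta> \<tau> - \<beta> 0 - \<tau> *\<^sub>R velocity \<beta> 0) + norm (\<alpha> \<tau> - \<beta> \<tau>) + norm (\<alpha> 0 - \<beta> 0)"
        by (intro order_trans[OF norm_triangle_ineq] order_trans[OF norm_triangle_ineq4] add_mono order_refl)
      finally have "1 / (2 * C) \<le> 2 * (L * h) + 1 / (4 * C) + 2 * (1 / (16 * C))"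
        using 1 3 4 5 unfolding 2 by linarith
      moreover have "L * h \<le> 1 / (32 * C)" using h(3) C by (simp add: field_simps)
      ultimately have "1 / (2 * C) \<le> 2 * (1 / (32 * C)) + 1 / (4 * C) + 2 * (1 / (16 * C))" by linarith
      \<comment> \<open>In units of \<open>1 / (16 * C)\<close> the inequality reads
        \<open>8 \<le> 1 + 4 + 2\<close>.\<close>
      then show False using C by (simp add: field_simps)
    qed
  qed
qed

text \<open>A difference quotient over a step \<open>h\<close> reproduces the velocity up to a
  multiple of \<open>h\<close>, while the quotients of two curves at distance \<delta> differ by at
  most \<open>2 * \<delta> / h\<close>. The length bound \<open>B\<close>, independent of \<eta>, is
  also exported because lengths enter the Sasaki estimate.\<close>

lemma velocity_locally_close:
  assumes \<alpha>: "\<alpha> \<in> curvature_bounded_curves \<kappa>\<^sub>1 \<kappa>\<^sub>2 P Q"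
  obtains B where "\<And>\<eta>. 0 < \<eta> \<Longrightarrow> \<exists>\<delta>>0. \<forall>\<beta>\<in>curvature_bounded_curves \<kappa>\<^sub>1 \<kappa>\<^sub>2 P Q.
      (\<forall>t\<in>{0..1}. norm (\<alpha> t - \<beta> t) \<le> \<delta>) \<longrightarrow>
      curve_length \<beta> \<le> B \<and> (\<forall>t\<in>{0..1}. norm (velocity \<alpha> t - velocity \<beta> t) \<le> \<eta>)"
proof -
  obtain B \<delta>0 where B: "0 < \<delta>0" "\<And>\<beta>. \<beta> \<in> curvature_bounded_curves \<kappa>\<^sub>1 \<kappa>\<^sub>2 P Q \<Longrightarrow>
      (\<And>t. t \<in> {0..1} \<Longrightarrow> norm (\<alpha> t - \<beta> t) \<le> \<delta>0) \<Longrightarrow> curve_length \<beta> \<le> B"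
    using curve_length_locally_bounded[OF \<alpha>] by metis
  define C where "C = 1 + max \<bar>\<kappa>\<^sub>1\<bar> \<bar>\<kappa>\<^sub>2\<bar>"
  \<comment> \<open>Sum of the Taylor constants of both curves, with 1 added to permit
    division.\<close>
  define \<Lambda> where "\<Lambda> = (curve_length \<alpha>)\<^sup>2 * C + B\<^sup>2 * C + 1"
  have C: "1 \<le> C" by (simp add: C_def)
  have \<Lambda>: "0 < \<Lambda>" using C by (simp add: \<Lambda>_def add_nonneg_pos)
  have "\<exists>\<delta>>0. \<forall>\<beta>\<in>curvature_bounded_curves \<kappa>\<^sub>1 \<kappa>\<^sub>2 P Q. (\<forall>t\<in>{0..1}. norm (\<alpha> t - \<beta> t) \<le> \<delta>) \<longrightarrow>
      curve_length \<beta> \<le> B \<and> (\<forall>t\<in>{0..1}. norm (velocity \<alpha> t - velocity \<beta> t) \<le> \<eta>)" if "0 < \<eta>" for \<eta>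
  proof -
    \<comment> \<open>With \<open>h\<close> at most 1/2, one of \<open>t + h\<close> and
      \<open>t - h\<close> lies in the unit interval. The other bound lets the Taylor remainders use
      half of \<eta>; the choice of \<delta> leaves the other half to the distance of the
      curves.\<close>
    define h where "h = min (1/2) (\<eta> / (2 * \<Lambda>))"
    have h: "0 < h" "h \<le> 1/2" "\<Lambda> * h \<le> \<eta> / 2" using \<Lambda> \<open>0 < \<eta>\<close> by (auto simp: h_def min_def field_simps)
    define \<delta> where "\<delta> = min \<delta>0 (\<eta> * h / 4)"
    have \<delta>: "0 < \<delta>" "\<delta> \<le> \<delta>0" "\<delta> \<le> \<eta> * h / 4" using B(1) h \<open>0 < \<eta>\<close> by (auto simp: \<delta>_def)
    have "curve_length \<beta> \<le> B \<and> (\<forall>t\<in>{0..1}. norm (velocity \<alpha> t - velocity \<beta> t) \<le> \<eta>)"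
      if \<beta>: "\<beta> \<in> curvature_bounded_curves \<kappa>\<^sub>1 \<kappa>\<^sub>2 P Q" and close: "\<forall>t\<in>{0..1}. norm (\<alpha> t - \<beta> t) \<le> \<delta>" for \<beta>
    proof
      show len: "curve_length \<beta> \<le> B" using B(2)[OF \<beta>] close \<delta>(2) by (meson order_trans)
      have "0 < curve_length \<beta>"
        using \<beta> curve_velocity(4)[of \<beta> 0] by (auto simp: curvature_bounded_curves_def curves_between_def)
      then have len2: "(curve_length \<beta>)\<^sup>2 * C \<le> B\<^sup>2 * C"
        using len C by (intro mult_right_mono power_mono) auto
      show "\<forall>t\<in>{0..1}. norm (velocity \<alpha> t - velocity \<beta> t) \<le> \<eta>"
      proof
        fix t :: real assume t: "t \<in> {0..1}"
        define s where "s = (if t \<le> 1/2 then t + h else t - h)"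
        have s: "s \<in> {0..1}" "\<bar>s - t\<bar> = h" "(s - t)\<^sup>2 = h\<^sup>2" using t h by (auto simp: s_def)
        let ?r = "\<lambda>\<gamma>. \<gamma> s - \<gamma> t - (s - t) *\<^sub>R velocity \<gamma> t"
        have "norm (?r \<alpha>) \<le> (curve_length \<alpha>)\<^sup>2 * C * h\<^sup>2" "norm (?r \<beta>) \<le> (curve_length \<beta>)\<^sup>2 * C * h\<^sup>2"
          using curve_Taylor[OF \<alpha> s(1) t] curve_Taylor[OF \<beta> s(1) t] by (simp_all add: C_def s(3))
        moreover have "(curve_length \<beta>)\<^sup>2 * C * h\<^sup>2 \<le> B\<^sup>2 * C * h\<^sup>2" using len2 by (rule mult_right_mono) simp
        moreover have "(curve_length \<alpha>)\<^sup>2 * C * h\<^sup>2 + B\<^sup>2 * C * h\<^sup>2 \<le> \<Lambda> * h\<^sup>2"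
          by (simp add: \<Lambda>_def algebra_simps)
        ultimately have 1: "norm (?r \<alpha>) + norm (?r \<beta>) \<le> \<Lambda> * h\<^sup>2" by linarith
        have "(s - t) *\<^sub>R (velocity \<alpha> t - velocity \<beta> t) = (\<alpha> s - \<beta> s) - (\<alpha> t - \<beta> t) - ?r \<alpha> + ?r \<beta>"
          by (simp add: algebra_simps)
        also have "norm \<dots> \<le> norm (\<alpha> s - \<beta> s) + norm (\<alpha> t - \<beta> t) + norm (?r \<alpha>) + norm (?r \<beta>)"
          by (intro order_trans[OF norm_triangle_ineq] order_trans[OF norm_triangle_ineq4] add_mono order_refl)
        also have "\<dots> \<le> 2 * \<delta> + \<Lambda> * h\<^sup>2"
          using 1 bspec[OF close s(1)] bspec[OF close t] by linarith
        also have "\<dots> \<le> \<eta> * h / 2 + \<eta> / 2 * h"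
        proof -
          have "\<Lambda> * h * h \<le> \<eta> / 2 * h" by (intro mult_right_mono) (use h in auto)
          then show ?thesis using \<delta>(3) by (simp add: power2_eq_square)
        qed
        finally have "h * norm (velocity \<alpha> t - velocity \<beta> t) \<le> h * \<eta>" using s(2) by (simp add: mult.commute)
        then show "norm (velocity \<alpha> t - velocity \<beta> t) \<le> \<eta>" using h(1) by simp
      qed
    qed
    then show ?thesis using \<delta>(1) by blast
  qed
  then show thesis by (rule that)
qed

section \<open>Comparison of the two metrics\<close>

text \<open>Covers \<open>d0\<close> and \<open>d1\<close> at once, \<open>F\<close> being the curve
  or the curve with its velocity. Reflexivity is required only along members of \<open>M\<close>,
  since a path distance is infinite from a point outside the underlying set to itself.\<close>

lemma Metric_space_enn2real_SUP:
  fixes \<rho> :: "'x \<Rightarrow> 'x \<Rightarrow> ennreal" and F :: "'c \<Rightarrow> 't \<Rightarrow> 'x"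
  assumes commute: "\<And>x y. \<rho> x y = \<rho> y x" and triangle: "\<And>x y z. \<rho> x z \<le> \<rho> x y + \<rho> y z"
    and refl: "\<And>a t. a \<in> M \<Longrightarrow> t \<in> T \<Longrightarrow> \<rho> (F a t) (F a t) = 0"
    and finite: "\<And>a b. a \<in> M \<Longrightarrow> b \<in> M \<Longrightarrow> (SUP t\<in>T. \<rho> (F a t) (F b t)) < \<infinity>"
    and separated: "\<And>a b. a \<in> M \<Longrightarrow> b \<in> M \<Longrightarrow> (\<And>t. t \<in> T \<Longrightarrow> \<rho> (F a t) (F b t) = 0) \<Longrightarrow> a = b"
  shows "Metric_space M (\<lambda>a b. enn2real (SUP t\<in>T. \<rho> (F a t) (F b t)))"
proof
  let ?S = "\<lambda>a b. SUP t\<in>T. \<rho> (F a t) (F b t)"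
  show "enn2real (?S a b) = enn2real (?S b a)" for a b by (simp add: commute)
  show "enn2real (?S a b) = 0 \<longleftrightarrow> a = b" if "a \<in> M" "b \<in> M" for a b
  proof
    assume "enn2real (?S a b) = 0"
    moreover have "s = 0" if "enn2real s = 0" "s < \<infinity>" for s
      using that by (auto simp: enn2real_eq_0_iff)
    ultimately have "?S a b = 0" using finite[OF that] by blast
    then have "\<rho> (F a t) (F b t) = 0" if "t \<in> T" for t
      using SUP_upper[OF that, of "\<lambda>t. \<rho> (F a t) (F b t)"] by simp
    then show "a = b" by (rule separated[OF that])
  next
    assume "a = b"
    then have "?S a b \<le> 0" using refl that by (intro SUP_least) simp
    then show "enn2real (?S a b) = 0" by simp
  qed
  show "enn2real (?S a c) \<le> enn2real (?S a b) + enn2real (?S b c)" if abc: "a \<in> M" "b \<in> M" "c \<in> M" for a b c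
  proof -
    have "?S a c \<le> ?S a b + ?S b c"
    proof (rule SUP_least)
      fix t assume "t \<in> T"
      then show "\<rho> (F a t) (F c t) \<le> ?S a b + ?S b c"
        by (intro order_trans[OF triangle[of _ _ "F b t"]] add_mono SUP_upper)
    qed
    then have "enn2real (?S a c) \<le> enn2real (?S a b + ?S b c)"
      using finite abc by (intro enn2real_mono) auto
    also have "\<dots> = enn2real (?S a b) + enn2real (?S b c)"
      using finite abc by (intro enn2real_plus) auto
    finally show ?thesis .
  qed
qed simp

text \<open>The hypothesis \<open>cont\<close> is continuity of the identity from \<open>d\<close>
  to \<open>d'\<close>. Here \<delta> may depend on \<open>x\<close>, as it must for a length bound
  that is only local.\<close>

lemma openin_mtopology_mono:
  assumes d: "Metric_space M d" and d': "Metric_space M d'"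
    and cont: "\<And>x e. x \<in> M \<Longrightarrow> 0 < e \<Longrightarrow> \<exists>\<delta>>0. \<forall>y\<in>M. d x y < \<delta> \<longrightarrow> d' x y < e"
    and U: "openin (Metric_space.mtopology M d') U"
  shows "openin (Metric_space.mtopology M d) U"
  unfolding Metric_space.openin_mtopology[OF d]
proof (intro conjI allI impI)
  have U': "U \<subseteq> M" "\<And>x. x \<in> U \<Longrightarrow> \<exists>r>0. Metric_space.mball M d' x r \<subseteq> U"
    using U unfolding Metric_space.openin_mtopology[OF d'] by auto
  show "U \<subseteq> M" by (rule U')
  fix x assume "x \<in> U"
  then obtain r where r: "0 < r" "Metric_space.mball M d' x r \<subseteq> U" using U' by blast
  obtain \<delta> where "0 < \<delta>" "\<forall>y\<in>M. d x y < \<delta> \<longrightarrow> d' x y < r" using cont[OF _ r(1)] \<open>x \<in> U\<close> U' by blast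
  then have "Metric_space.mball M d x \<delta> \<subseteq> U"
    using r(2) by (auto simp: Metric_space.mball_def[OF d] Metric_space.mball_def[OF d'])
  then show "\<exists>r>0. Metric_space.mball M d x r \<subseteq> U" using \<open>0 < \<delta>\<close> by blast
qed

lemma sasaki_dist_curves:
  assumes "C1_regular_curve \<alpha>" "C1_regular_curve \<beta>" "t \<in> {0..1}"
  shows "sasaki_dist (\<alpha> t, velocity \<alpha> t) (\<beta> t, velocity \<beta> t)
    \<le> ennreal (arccos (\<alpha> t \<bullet> \<beta> t) * (1 + curve_length \<alpha> + curve_length \<beta>) + norm (velocity \<alpha> t - velocity \<beta> t))"
  using sasaki_dist_le[of "\<alpha> t" "velocity \<alpha> t" "\<beta> t" "velocity \<beta> t"]
    curve_velocity[OF assms(1,3)] curve_velocity[OF assms(2,3)] by simp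

text \<open>Needed because \<open>enn2real\<close> sends infinity to 0, which would destroy the
  metric axioms. Angles are at most \<open>pi\<close> and speeds are constant, so the bound is
  uniform in \<open>t\<close>.\<close>

lemma SUP_sasaki_dist_finite:
  assumes "C1_regular_curve \<alpha>" "C1_regular_curve \<beta>"
  shows "(SUP t\<in>{0..1}. sasaki_dist (\<alpha> t, velocity \<alpha> t) (\<beta> t, velocity \<beta> t)) < \<infinity>"
proof -
  let ?b = "pi * (1 + curve_length \<alpha> + curve_length \<beta>) + (curve_length \<alpha> + curve_length \<beta>)"
  have "sasaki_dist (\<alpha> t, velocity \<alpha> t) (\<beta> t, velocity \<beta> t) \<le> ennreal ?b" if t: "t \<in> {0..1}" for t
  proof -
    note c = curve_velocity[OF assms(1) t] curve_velocity[OF assms(2) t]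
    have "\<bar>\<alpha> t \<bullet> \<beta> t\<bar> \<le> 1" using Cauchy_Schwarz_ineq2[of "\<alpha> t" "\<beta> t"] c by simp
    then have "arccos (\<alpha> t \<bullet> \<beta> t) \<le> pi" by (intro arccos_ubound) auto
    then have "arccos (\<alpha> t \<bullet> \<beta> t) * (1 + curve_length \<alpha> + curve_length \<beta>) \<le> pi * (1 + curve_length \<alpha> + curve_length \<beta>)"
      using c by (intro mult_right_mono) auto
    moreover have "norm (velocity \<alpha> t - velocity \<beta> t) \<le> curve_length \<alpha> + curve_length \<beta>"
      using norm_triangle_ineq4[of "velocity \<alpha> t" "velocity \<beta> t"] c by simp
    ultimately show ?thesis
      by (intro order_trans[OF sasaki_dist_curves[OF assms t]] ennreal_leI) linarith
  qed
  then have "(SUP t\<in>{0..1}. sasaki_dist (\<alpha> t, velocity \<alpha> t) (\<beta> t, velocity \<beta> t)) \<le> ennreal ?b"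
    by (rule SUP_least)
  then show ?thesis by (simp add: le_less_trans)
qed

theorem theorem2:
  fixes \<kappa>\<^sub>1 \<kappa>\<^sub>2 :: real and P Q :: "real^3^3"
  assumes "\<kappa>\<^sub>1 < \<kappa>\<^sub>2" and "rotation_matrix P" and "rotation_matrix Q"
  shows "Metric_space (curvature_bounded_curves \<kappa>\<^sub>1 \<kappa>\<^sub>2 P Q) d0 \<and>
         Metric_space (curvature_bounded_curves \<kappa>\<^sub>1 \<kappa>\<^sub>2 P Q) d1 \<and>
         Metric_space.mtopology (curvature_bounded_curves \<kappa>\<^sub>1 \<kappa>\<^sub>2 P Q) d0 =
         Metric_space.mtopology (curvature_bounded_curves \<kappa>\<^sub>1 \<kappa>\<^sub>2 P Q) d1"
proof -
  let ?M = "curvature_bounded_curves \<kappa>\<^sub>1 \<kappa>\<^sub>2 P Q"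
  let ?S0 = "\<lambda>\<alpha> \<beta>. SUP t\<in>{0..1}. sphere_dist (\<alpha> t) (\<beta> t)"
  let ?S1 = "\<lambda>\<alpha> \<beta>. SUP t\<in>{0..1}. sasaki_dist (\<alpha> t, velocity \<alpha> t) (\<beta> t, velocity \<beta> t)"
  have reg: "C1_regular_curve \<gamma>" if "\<gamma> \<in> ?M" for \<gamma>
    using that by (simp add: curvature_bounded_curves_def curves_between_def)
  have fin1: "?S1 \<alpha> \<beta> < \<infinity>" if "\<alpha> \<in> ?M" "\<beta> \<in> ?M" for \<alpha> \<beta>
    using SUP_sasaki_dist_finite reg that by blast
  have le01: "?S0 \<alpha> \<beta> \<le> ?S1 \<alpha> \<beta>" for \<alpha> \<beta>
    by (intro SUP_mono') (rule sphere_dist_le_sasaki_dist)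
  have fin0: "?S0 \<alpha> \<beta> < \<infinity>" if "\<alpha> \<in> ?M" "\<beta> \<in> ?M" for \<alpha> \<beta>
    using le_less_trans[OF le01 fin1[OF that]] .
  \<comment> \<open>At equal arguments the explicit upper bound vanishes, because
    \<open>arccos 1 = 0\<close>.\<close>
  have refl1: "sasaki_dist (\<gamma> t, velocity \<gamma> t) (\<gamma> t, velocity \<gamma> t) = 0" if "\<gamma> \<in> ?M" "t \<in> {0..1}" for \<gamma> t
  proof -
    have "\<gamma> t \<bullet> \<gamma> t = 1" using curve_velocity(2)[OF reg[OF that(1)] that(2)] by (simp add: dot_square_norm)
    then show ?thesis using sasaki_dist_curves[OF reg reg, OF that(1) that(1) that(2)] by simp
  qed
  have refl0: "sphere_dist (\<gamma> t) (\<gamma> t) = 0" if "\<gamma> \<in> ?M" "t \<in> {0..1}" for \<gamma> t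
    using sphere_dist_le_sasaki_dist[of "\<gamma> t" "\<gamma> t" "velocity \<gamma> t" "velocity \<gamma> t"] refl1[OF that] by simp
  have sep0: "\<alpha> = \<beta>" if "\<alpha> \<in> ?M" "\<beta> \<in> ?M" and 0: "\<And>t. t \<in> {0..1} \<Longrightarrow> sphere_dist (\<alpha> t) (\<beta> t) = 0" for \<alpha> \<beta>
  proof (rule extensionalityI)
    show "\<alpha> \<in> extensional {0..1}" "\<beta> \<in> extensional {0..1}"
      using reg that by (auto simp: C1_regular_curve_def)
    show "\<alpha> t = \<beta> t" if "t \<in> {0..1}" for t
      using norm_le_sphere_dist[of "\<alpha> t" "\<beta> t"] 0[OF that] by simp
  qed
  have sep1: "\<alpha> = \<beta>" if "\<alpha> \<in> ?M" "\<beta> \<in> ?M"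
      and sep1_0: "\<And>t. t \<in> {0..1} \<Longrightarrow> sasaki_dist (\<alpha> t, velocity \<alpha> t) (\<beta> t, velocity \<beta> t) = 0" for \<alpha> \<beta>
  proof (rule sep0[OF that(1,2)])
    show "sphere_dist (\<alpha> t) (\<beta> t) = 0" if "t \<in> {0..1}" for t
      using sphere_dist_le_sasaki_dist[of "\<alpha> t" "\<beta> t" "velocity \<alpha> t" "velocity \<beta> t"] sep1_0[OF that] by simp
  qed
  have M0: "Metric_space ?M d0"
  proof -
    have "Metric_space ?M (\<lambda>\<alpha> \<beta>. enn2real (?S0 \<alpha> \<beta>))"
    proof (rule Metric_space_enn2real_SUP[where F = "\<lambda>\<gamma> t. \<gamma> t"])
      show "sphere_dist x y = sphere_dist y x" for x y
        unfolding sphere_dist_eq by (rule sphere.path_dist_commute)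
      show "sphere_dist x z \<le> sphere_dist x y + sphere_dist y z" for x y z
        unfolding sphere_dist_eq by (rule sphere.path_dist_triangle)
    qed (fact refl0 fin0 sep0)+
    then show ?thesis by (simp add: d0_def[abs_def])
  qed
  have M1: "Metric_space ?M d1"
  proof -
    have "Metric_space ?M (\<lambda>\<alpha> \<beta>. enn2real (?S1 \<alpha> \<beta>))"
    proof (rule Metric_space_enn2real_SUP[where F = "\<lambda>\<gamma> t. (\<gamma> t, velocity \<gamma> t)"])
      show "sasaki_dist x y = sasaki_dist y x" for x y
        unfolding sasaki_dist_eq by (rule sasaki.path_dist_commute)
      show "sasaki_dist x z \<le> sasaki_dist x y + sasaki_dist y z" for x y z
        unfolding sasaki_dist_eq by (rule sasaki.path_dist_triangle)
    qed (fact refl1 fin1 sep1)+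
    then show ?thesis by (simp add: d1_def[abs_def])
  qed
  have d0_le_d1: "d0 \<alpha> \<beta> \<le> d1 \<alpha> \<beta>" if "\<alpha> \<in> ?M" "\<beta> \<in> ?M" for \<alpha> \<beta>
    unfolding d0_def d1_def using le01 fin1[OF that] by (intro enn2real_mono) auto
  have norm_le_d0: "norm (\<alpha> t - \<beta> t) \<le> d0 \<alpha> \<beta>" if "\<alpha> \<in> ?M" "\<beta> \<in> ?M" "t \<in> {0..1}" for \<alpha> \<beta> t
  proof -
    have "ennreal (norm (\<alpha> t - \<beta> t)) \<le> ?S0 \<alpha> \<beta>"
      using norm_le_sphere_dist SUP_upper[OF that(3), of "\<lambda>t. sphere_dist (\<alpha> t) (\<beta> t)"] by (rule order_trans)
    then have "enn2real (ennreal (norm (\<alpha> t - \<beta> t))) \<le> d0 \<alpha> \<beta>"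
      unfolding d0_def using fin0[OF that(1,2)] by (intro enn2real_mono) auto
    then show ?thesis by simp
  qed
  have cont: "\<exists>\<delta>>0. \<forall>\<beta>\<in>?M. d0 \<alpha> \<beta> < \<delta> \<longrightarrow> d1 \<alpha> \<beta> < e" if \<alpha>: "\<alpha> \<in> ?M" and "0 < e" for \<alpha> e
  proof -
    obtain B where B: "\<And>\<eta>. 0 < \<eta> \<Longrightarrow> \<exists>\<delta>>0. \<forall>\<beta>\<in>?M. (\<forall>t\<in>{0..1}. norm (\<alpha> t - \<beta> t) \<le> \<delta>) \<longrightarrow>
        curve_length \<beta> \<le> B \<and> (\<forall>t\<in>{0..1}. norm (velocity \<alpha> t - velocity \<beta> t) \<le> \<eta>)"
      using velocity_locally_close[OF \<alpha>] by metis
    \<comment> \<open>The velocity and angle terms of the Sasaki bound get \<open>e/4\<close> each.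
      The total \<open>e/2\<close> survives the supremum and still leaves \<open>d1\<close> strictly
      below \<open>e\<close>.\<close>
    have "0 < e/4" using \<open>0 < e\<close> by simp
    from B[OF this] obtain \<delta>1 where \<delta>1: "0 < \<delta>1" "\<And>\<beta>. \<beta> \<in> ?M \<Longrightarrow> \<forall>t\<in>{0..1}. norm (\<alpha> t - \<beta> t) \<le> \<delta>1 \<Longrightarrow>
        curve_length \<beta> \<le> B \<and> (\<forall>t\<in>{0..1}. norm (velocity \<alpha> t - velocity \<beta> t) \<le> e/4)"
      by blast
    \<comment> \<open>\<open>D\<close> bounds the factor of the angle in
      \<open>sasaki_dist_curves\<close>; the absolute value makes it positive whatever the sign of
      \<open>B\<close>.\<close>
    define D where "D = 1 + curve_length \<alpha> + \<bar>B\<bar>"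
    have L: "0 < curve_length \<alpha>" using curve_velocity(4)[OF reg[OF \<alpha>], of 0] by simp
    then have D: "0 < D" by (simp add: D_def)
    have "0 < e / (4 * D)" using D \<open>0 < e\<close> by simp
    from arccos_inner_small[OF this, where 'a = "real^3"] obtain \<delta>2 where \<delta>2: "0 < \<delta>2"
      "\<And>p q :: real^3. norm p = 1 \<Longrightarrow> norm q = 1 \<Longrightarrow> norm (p - q) < \<delta>2 \<Longrightarrow> arccos (p \<bullet> q) < e / (4 * D)"
      by metis
    have "d1 \<alpha> \<beta> < e" if \<beta>: "\<beta> \<in> ?M" and d: "d0 \<alpha> \<beta> < min \<delta>1 \<delta>2" for \<beta>
    proof -
      have close: "norm (\<alpha> t - \<beta> t) < min \<delta>1 \<delta>2" if "t \<in> {0..1}" for t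
        using le_less_trans[OF norm_le_d0[OF \<alpha> \<beta> that] d] .
      then have "\<forall>t\<in>{0..1}. norm (\<alpha> t - \<beta> t) \<le> \<delta>1" by (auto intro: less_imp_le)
      note \<beta>B = \<delta>1(2)[OF \<beta> this]
      have "sasaki_dist (\<alpha> t, velocity \<alpha> t) (\<beta> t, velocity \<beta> t) \<le> ennreal (e/2)" if t: "t \<in> {0..1}" for t
      proof -
        have "arccos (\<alpha> t \<bullet> \<beta> t) \<le> e / (4 * D)"
          using \<delta>2(2)[of "\<alpha> t" "\<beta> t"] close[OF t] curve_velocity(2)[OF reg[OF \<alpha>] t] curve_velocity(2)[OF reg[OF \<beta>] t] by simp
        moreover have "1 + curve_length \<alpha> + curve_length \<beta> \<le> D" using conjunct1[OF \<beta>B] unfolding D_def by linarith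
        moreover have "0 < curve_length \<beta>" using curve_velocity(4)[OF reg[OF \<beta>] t] .
        ultimately have "arccos (\<alpha> t \<bullet> \<beta> t) * (1 + curve_length \<alpha> + curve_length \<beta>) \<le> e / (4 * D) * D"
          using L D \<open>0 < e\<close> by (intro mult_mono) auto
        also have "\<dots> = e/4" using D by simp
        finally show ?thesis
          using bspec[OF conjunct2[OF \<beta>B] t]
          by (intro order_trans[OF sasaki_dist_curves[OF reg[OF \<alpha>] reg[OF \<beta>] t]] ennreal_leI) linarith
      qed
      then have "?S1 \<alpha> \<beta> \<le> ennreal (e/2)" by (rule SUP_least)
      then have "d1 \<alpha> \<beta> \<le> e/2" unfolding d1_def using \<open>0 < e\<close> by (intro enn2real_leI) auto
      then show ?thesis using \<open>0 < e\<close> by simp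
    qed
    then show ?thesis using \<delta>1(1) \<delta>2(1) by (intro exI[of _ "min \<delta>1 \<delta>2"]) auto
  qed
  have "openin (Metric_space.mtopology ?M d0) U \<longleftrightarrow> openin (Metric_space.mtopology ?M d1) U" for U
  proof
    assume "openin (Metric_space.mtopology ?M d0) U"
    then show "openin (Metric_space.mtopology ?M d1) U"
      \<comment> \<open>Here \<delta> can be taken to be \<open>e\<close> itself.\<close>
      by (rule openin_mtopology_mono[OF M1 M0, rotated]) (use d0_le_d1 le_less_trans in blast)
  next
    assume "openin (Metric_space.mtopology ?M d1) U"
    then show "openin (Metric_space.mtopology ?M d0) U"
      by (rule openin_mtopology_mono[OF M0 M1 cont, rotated 2])
  qed
  then show ?thesis using M0 M1 by (simp add: topology_eq)
qed

end
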